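(* Let $n\ge 1$ and let $\mathcal{H}\subset \mathbb{R}^{n+1}$ be a projective special real manifold endowed with its centroaffine metric $g$. Then the Riemannian manifold $(\mathcal{H},g)$ is complete if and only if $\mathcal{H}$ is a closed subset of $\mathbb{R}^{n+1}$.
   Context: Let $\tilde\nabla$ denote the canonical flat connection on $\mathbb{R}^{n+1}$, so that $\tilde\nabla^2 h$ is the Hessian of a function $h$. A projective special real manifold is a smooth (embedded, not necessarily connected) hypersurface $\mathcal{H}\subset\mathbb{R}^{n+1}$ for which there exists a homogeneous cubic polynomial $h$ on $\mathbb{R}^{n+1}$ such that (i) $\mathcal{H}\subset\{x\in\mathbb{R}^{n+1}\mid h(x)=1\}$ and (ii) the Hessian $\tilde\nabla^2h$ is negative definite on $T\mathcal{H}$. Its centroaffine metric is the Riemannian metric $g=-\frac13\iota^*(\tilde\nabla^2h)$, where $\iota:\mathcal{H}\to\mathbb{R}^{n+1}$ is the inclusion. (Equivalently, $g$ is determined by the decomposition $\tilde\nabla_XY=\nabla_XY+g(X,Y)\xi$ for vector fields $X,Y$ tangent to $\mathcal{H}$, with $\nabla_XY$ tangent to $\mathcal{H}$ and $\xi$ the position vector field.) A possibly disconnected Riemannian manifold is called complete if each of its connected components is complete. *)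

theory Defs
  imports "HOL-Analysis.Analysis"
begin

section \<open>Smooth maps, embedded hypersurfaces, tangent vectors\<close>

text \<open>Only meant for open \<open>S\<close>: the derivatives are the ordinary (two-sided) ones, and
  all iterated directional derivatives up to order \<open>k\<close> are required to be continuous.\<close>

primrec Ck_on :: "nat \<Rightarrow> 'a::real_normed_vector set \<Rightarrow> ('a \<Rightarrow> 'b::real_normed_vector) \<Rightarrow> bool"
where
  "Ck_on 0 S f \<longleftrightarrow> continuous_on S f"
| "Ck_on (Suc k) S f \<longleftrightarrow>
     (\<forall>x\<in>S. f differentiable (at x)) \<and>
     (\<forall>v. Ck_on k S (\<lambda>x. frechet_derivative f (at x) v))"

definition smooth_map_on :: "'a::real_normed_vector set \<Rightarrow> ('a \<Rightarrow> 'b::real_normed_vector) \<Rightarrow> bool"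
  where "smooth_map_on S f \<longleftrightarrow> (\<forall>k. Ck_on k S f)"

text \<open>Embedded (not necessarily closed or connected) hypersurface: around each of its points
  there is a diffeomorphism \<open>\<Phi>\<close> between open sets of the ambient space that flattens
  \<open>H\<close> to a coordinate hyperplane.\<close>

definition smooth_hypersurface :: "(real^'m) set \<Rightarrow> bool"
  where "smooth_hypersurface H \<longleftrightarrow>
    (\<forall>p\<in>H. \<exists>U (V :: (real^'m) set) \<Phi> \<Psi> k. open U \<and> p \<in> U \<and> open V \<and> homeomorphism U V \<Phi> \<Psi> \<and>
       smooth_map_on U \<Phi> \<and> smooth_map_on V \<Psi> \<and> \<Phi> ` (H \<inter> U) = V \<inter> {y. y $ k = 0})"

text \<open>Velocities at \<open>p\<close> of smooth curves in \<open>H\<close> through \<open>p\<close>.\<close>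

definition tangent_space :: "(real^'m) set \<Rightarrow> real^'m \<Rightarrow> (real^'m) set"
  where "tangent_space H p =
    {v. \<exists>\<gamma> \<epsilon>. \<epsilon> > 0 \<and> smooth_map_on {-\<epsilon><..<\<epsilon>} \<gamma> \<and> \<gamma> ` {-\<epsilon><..<\<epsilon>} \<subseteq> H \<and> \<gamma> 0 = p \<and>
       (\<gamma> has_vector_derivative v) (at (0::real))}"


section \<open>Projective special real manifolds\<close>

definition homogeneous_cubic :: "(real^'m \<Rightarrow> real) \<Rightarrow> bool"
  where "homogeneous_cubic h \<longleftrightarrow>
    (\<exists>c. \<forall>x. h x = (\<Sum>i\<in>UNIV. \<Sum>j\<in>UNIV. \<Sum>k\<in>UNIV. c i j k * x $ i * x $ j * x $ k))"

definition hessian :: "(real^'m \<Rightarrow> real) \<Rightarrow> real^'m \<Rightarrow> real^'m \<Rightarrow> real^'m \<Rightarrow> real"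
  where "hessian h p v w =
    frechet_derivative (\<lambda>x. frechet_derivative h (at x) w) (at p) v"

definition defining_cubic :: "(real^'m) set \<Rightarrow> (real^'m \<Rightarrow> real) \<Rightarrow> bool"
  where "defining_cubic H h \<longleftrightarrow>
    homogeneous_cubic h \<and> H \<subseteq> {x. h x = 1} \<and>
    (\<forall>p\<in>H. \<forall>v\<in>tangent_space H p. v \<noteq> 0 \<longrightarrow> hessian h p v v < 0)"

definition projective_special_real_manifold :: "(real^'m) set \<Rightarrow> bool"
  where "projective_special_real_manifold H \<longleftrightarrow>
    smooth_hypersurface H \<and> (\<exists>h. defining_cubic H h)"

text \<open>Written as a bilinear form on the whole ambient space; only its values on vectors
  tangent to \<open>H\<close> matter below, and there it is a Riemannian metric.\<close>

definition centroaffine_metric :: "(real^'m \<Rightarrow> real) \<Rightarrow> real^'m \<Rightarrow> real^'m \<Rightarrow> real^'m \<Rightarrow> real"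
  where "centroaffine_metric h p v w = - (1/3) * hessian h p v w"


section \<open>Riemannian distance and completeness\<close>

definition speed :: "('a \<Rightarrow> 'a \<Rightarrow> 'a \<Rightarrow> real) \<Rightarrow> (real \<Rightarrow> 'a::real_normed_vector) \<Rightarrow> real \<Rightarrow> real"
  where "speed g \<gamma> t =
    sqrt (g (\<gamma> t) (vector_derivative \<gamma> (at t)) (vector_derivative \<gamma> (at t)))"

definition curve_length :: "('a \<Rightarrow> 'a \<Rightarrow> 'a \<Rightarrow> real) \<Rightarrow> (real \<Rightarrow> 'a::real_normed_vector) \<Rightarrow> real"
  where "curve_length g \<gamma> = integral {0..1} (speed g \<gamma>)"

text \<open>Piecewise C1 curves of finite length. The integrability condition is needed because
  the library's piecewise C1 paths may have unbounded velocity near the finitely many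
  exceptional parameters, and the integral of a non-integrable function is 0 by convention.\<close>

definition curves_between ::
    "('a \<Rightarrow> 'a \<Rightarrow> 'a \<Rightarrow> real) \<Rightarrow> 'a set \<Rightarrow> 'a \<Rightarrow> 'a \<Rightarrow> (real \<Rightarrow> 'a::real_normed_vector) set"
  where "curves_between g C p q =
    {\<gamma>. valid_path \<gamma> \<and> path_image \<gamma> \<subseteq> C \<and> pathstart \<gamma> = p \<and> pathfinish \<gamma> = q \<and>
        speed g \<gamma> integrable_on {0..1}}"

text \<open>Used for a connected manifold \<open>C\<close>; the value outside \<open>C\<close> is a dummy.\<close>

definition riemannian_dist ::
    "('a \<Rightarrow> 'a \<Rightarrow> 'a \<Rightarrow> real) \<Rightarrow> 'a::real_normed_vector set \<Rightarrow> 'a \<Rightarrow> 'a \<Rightarrow> real"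
  where "riemannian_dist g C p q =
    (if p \<in> C \<and> q \<in> C then INF \<gamma>\<in>curves_between g C p q. curve_length g \<gamma> else 0)"

definition riemannian_complete ::
    "'a::real_normed_vector set \<Rightarrow> ('a \<Rightarrow> 'a \<Rightarrow> 'a \<Rightarrow> real) \<Rightarrow> bool"
  where "riemannian_complete H g \<longleftrightarrow>
    (\<forall>C\<in>components H. Metric_space.mcomplete C (riemannian_dist g C))"

end

theory Submission
  imports Defs
begin

text \<open>
  Write the cubic as \<open>h x = T x x x\<close> with a symmetric trilinear form \<open>T\<close>. The centroaffine metric at
  \<open>p\<close> is then \<open>- 2 * T p v w\<close>, the tangent space at \<open>p\<close> is the kernel of \<open>T p p\<close>, and invariance of
  domain shows that \<open>H\<close> is open in the level set \<open>h = 1\<close> (\<open>hypersurface_open_in_level_set\<close>).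

  If \<open>H\<close> is not closed, a limit point \<open>p\<close> of \<open>H\<close> outside \<open>H\<close> still lies on the level set, and
  a short arc in the level set towards \<open>p\<close> leaves \<open>H\<close> after finite length. Since Riemannian
  convergence in \<open>H\<close> implies Euclidean convergence, \<open>H\<close> is incomplete (\<open>complete_imp_closed\<close>).

  If \<open>H\<close> is closed, then it is open and closed in the level set. For a tangent vector \<open>w\<close> at \<open>p\<close>
  this forces the restriction of \<open>h\<close> to the line through \<open>p\<close> in direction \<open>w\<close> to have only real
  roots: otherwise the line could be followed, projected to \<open>H\<close>, up to a critical point of the
  restriction where its second derivative is positive, contradicting the sign of the Hessian
  on \<open>H\<close>. Nonnegativity of the discriminant is the estimate \<open>cubic_bound\<close>, which bounds the cubic
  form \<open>T w w w\<close> by the metric, uniformly on \<open>H\<close>.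
  Extend the metric to the positive definite form \<open>- 2 * T x v v + 3 * (T x x v)\<^sup>2\<close> on the ambient
  space. By the estimate, the logarithm of its value on a fixed vector \<open>v\<close> is Lipschitz for the
  Riemannian distance, as a function of \<open>x\<close> (\<open>full_form_growth\<close>). Applied to \<open>v = y\<close>, where the form
  at \<open>y\<close> has the value 1, this shows that Riemannian balls are Euclidean bounded. Hence
  Cauchy sequences subconverge, and completeness follows (\<open>closed_imp_complete\<close>).
\<close>

section \<open>Symmetric trilinear forms\<close>

locale symmetric_trilinear =
  fixes T :: "'a::euclidean_space \<Rightarrow> 'a \<Rightarrow> 'a \<Rightarrow> real"
  assumes linear_first: "linear (\<lambda>x. T x y z)"
    and swap12: "T x y z = T y x z"
    and swap23: "T x y z = T x z y"
begin

lemma swap_last_to_first: "T d x y = T x y d"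
  by (metis swap12 swap23)

lemma add1: "T (x + x') y z = T x y z + T x' y z"
  using linear_first[of y z] by (rule linear_add)

lemma scale1: "T (a *\<^sub>R x) y z = a * T x y z"
  using linear_scale[OF linear_first[of y z], of a x] by simp

lemma sum1: "T (sum f S) y z = (\<Sum>i\<in>S. T (f i) y z)"
  using linear_sum[OF linear_first[of y z], of f S] .

lemma add2: "T x (y + y') z = T x y z + T x y' z"
  by (metis add1 swap12)

lemma scale2: "T x (a *\<^sub>R y) z = a * T x y z"
  by (metis scale1 swap12)

lemma add3: "T x y (z + z') = T x y z + T x y z'"
  by (metis add2 swap23)

lemma scale3: "T x y (a *\<^sub>R z) = a * T x y z"
  by (metis scale2 swap23)

lemma diff1: "T (x - x') y z = T x y z - T x' y z"
  using linear_first[of y z] by (rule linear_diff)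

lemma diff2: "T x (y - y') z = T x y z - T x y' z"
  by (metis diff1 swap12)

lemma diff3: "T x y (z - z') = T x y z - T x y z'"
  by (metis diff2 swap23)

lemma zero [simp]: "T 0 y z = 0" "T x 0 z = 0" "T x y 0 = 0"
  using scale1[of 0] scale2[of _ 0] scale3[of _ _ 0] by auto

lemma minus: "T x y (- z) = - T x y z" "T x (- y) z = - T x y z" "T (- x) y z = - T x y z"
  using scale3[of x y "-1" z] scale2[of x "-1" y z] scale1[of "-1" x y z] by auto

lemmas trilinear_simps = add1 add2 add3 diff1 diff2 diff3 scale1 scale2 scale3

text \<open>In coordinates, continuity and differentiability of \<open>T\<close> come down to the rules for
  finite sums and products.\<close>

lemma coordinates:
  "T x y z = (\<Sum>a\<in>Basis. \<Sum>b\<in>Basis. \<Sum>c\<in>Basis. (x \<bullet> a) * (y \<bullet> b) * (z \<bullet> c) * T a b c)"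
proof -
  have 1: "T x y z = (\<Sum>a\<in>Basis. (x \<bullet> a) * T a y z)" for x y z
    by (subst (1) euclidean_representation[of x, symmetric]) (simp only: sum1 scale1)
  have 2: "T x y z = (\<Sum>b\<in>Basis. (y \<bullet> b) * T x b z)" for x y z
    using 1[of y x z] by (simp only: swap12[of _ x])
  have 3: "T x y z = (\<Sum>c\<in>Basis. (z \<bullet> c) * T x y c)" for x y z
    using 2[of x z y] by (simp only: swap23[of x _ y])
  have 4: "T a y z = (\<Sum>b\<in>Basis. (y \<bullet> b) * (\<Sum>c\<in>Basis. (z \<bullet> c) * T a b c))" for a
    by (subst 2) (simp only: 3[of a _ z])
  have "T x y z = (\<Sum>a\<in>Basis. (x \<bullet> a) * (\<Sum>b\<in>Basis. (y \<bullet> b) * (\<Sum>c\<in>Basis. (z \<bullet> c) * T a b c)))"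
    by (subst 1) (simp only: 4)
  also have "\<dots> = (\<Sum>a\<in>Basis. \<Sum>b\<in>Basis. \<Sum>c\<in>Basis. (x \<bullet> a) * (y \<bullet> b) * (z \<bullet> c) * T a b c)"
    by (simp add: sum_distrib_left mult.assoc)
  finally show ?thesis .
qed

lemma has_derivative_T:
  assumes "(f has_derivative f') (at x within S)" "(g has_derivative g') (at x within S)"
    "(k has_derivative k') (at x within S)"
  shows "((\<lambda>x. T (f x) (g x) (k x)) has_derivative
    (\<lambda>d. T (f' d) (g x) (k x) + T (f x) (g' d) (k x) + T (f x) (g x) (k' d))) (at x within S)"
proof -
  have "((\<lambda>x. \<Sum>a\<in>Basis. \<Sum>b\<in>Basis. \<Sum>c\<in>Basis. (f x \<bullet> a) * (g x \<bullet> b) * (k x \<bullet> c) * T a b c)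
    has_derivative (\<lambda>d. \<Sum>a\<in>Basis. \<Sum>b\<in>Basis. \<Sum>c\<in>Basis.
      (f' d \<bullet> a) * (g x \<bullet> b) * (k x \<bullet> c) * T a b c
      + (f x \<bullet> a) * (g' d \<bullet> b) * (k x \<bullet> c) * T a b c
      + (f x \<bullet> a) * (g x \<bullet> b) * (k' d \<bullet> c) * T a b c)) (at x within S)"
    by (auto intro!: derivative_eq_intros assms simp: algebra_simps)
  then show ?thesis
    by (simp add: sum.distrib flip: coordinates)
qed

lemma has_vector_derivative_T:
  assumes "(f has_vector_derivative f') (at x within S)" "(g has_vector_derivative g') (at x within S)"
    "(k has_vector_derivative k') (at x within S)"
  shows "((\<lambda>x. T (f x) (g x) (k x)) has_real_derivative
    (T f' (g x) (k x) + T (f x) g' (k x) + T (f x) (g x) k')) (at x within S)"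
  using has_derivative_T[OF assms[unfolded has_vector_derivative_def]]
  unfolding has_field_derivative_def
  by (rule has_derivative_eq_rhs) (simp add: fun_eq_iff trilinear_simps algebra_simps)

lemma continuous_on_T [continuous_intros]:
  assumes "continuous_on S f" "continuous_on S g" "continuous_on S k"
  shows "continuous_on S (\<lambda>x. T (f x) (g x) (k x))"
  by (subst coordinates) (intro continuous_intros assms)

end

section \<open>Lengths of piecewise C1 curves\<close>

lemma valid_path_has_vector_derivative:
  assumes "valid_path \<gamma>"
  obtains S where "finite S"
    "\<And>t. t \<in> {0..1} - S \<Longrightarrow> (\<gamma> has_vector_derivative vector_derivative \<gamma> (at t)) (at t)"
proof -
  obtain S where "finite S" and S: "\<gamma> C1_differentiable_on ({0..1} - S)"
    using assms by (auto simp: valid_path_def piecewise_C1_differentiable_on_def)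
  with that[of S] show thesis
    by (auto simp: C1_differentiable_on_eq vector_derivative_works)
qed

text \<open>Homogeneity of degree two of \<open>g p\<close> is all that reparametrisation needs.\<close>

locale quadratic_speed =
  fixes g :: "'a::real_normed_vector \<Rightarrow> 'a \<Rightarrow> 'a \<Rightarrow> real"
  assumes quadratic: "g p (a *\<^sub>R v) (a *\<^sub>R v) = a\<^sup>2 * g p v v"
begin

lemma speed_scaled:
  assumes "((\<lambda>s. \<gamma> (a * s + b)) has_vector_derivative a *\<^sub>R v) (at t)"
    and "(\<gamma> has_vector_derivative v) (at (a * t + b))"
  shows "speed g (\<lambda>s. \<gamma> (a * s + b)) t = \<bar>a\<bar> * speed g \<gamma> (a * t + b)"
  unfolding speed_def vector_derivative_at[OF assms(1)] vector_derivative_at[OF assms(2)] quadratic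
  by (simp add: real_sqrt_mult)

lemma has_vector_derivative_affine:
  assumes "(\<gamma> has_vector_derivative v) (at (a * t + b))"
  shows "((\<lambda>s. \<gamma> (a * s + b)) has_vector_derivative a *\<^sub>R v) (at (t::real))"
proof -
  have "((\<lambda>s. a * s + b) has_vector_derivative a) (at t)"
    by (auto intro!: derivative_eq_intros simp flip: has_real_derivative_iff_has_vector_derivative)
  from vector_diff_chain_at[OF this assms] show ?thesis
    by (simp add: o_def)
qed

lemma speed_affine:
  assumes "(\<gamma> has_vector_derivative v) (at (a * t + b))"
  shows "speed g (\<lambda>s. \<gamma> (a * s + b)) t = \<bar>a\<bar> * speed g \<gamma> (a * t + b)"
  using speed_scaled[OF has_vector_derivative_affine[OF assms] assms] .

lemma speed_cong:
  assumes "0 < e" "\<And>s. \<bar>s - t\<bar> < e \<Longrightarrow> \<gamma> s = \<gamma>' s" "(\<gamma>' has_vector_derivative v) (at t)"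
  shows "speed g \<gamma> t = speed g \<gamma>' t"
proof -
  have "(\<gamma> has_vector_derivative v) (at t)"
    by (rule has_vector_derivative_transform_within[OF assms(3) assms(1)])
      (use assms(2) in \<open>auto simp: dist_real_def\<close>)
  with assms show ?thesis
    unfolding speed_def by (simp add: vector_derivative_at)
qed

lemma curves_between_reverse:
  assumes "\<gamma> \<in> curves_between g C p q"
  shows "reversepath \<gamma> \<in> curves_between g C q p" "curve_length g (reversepath \<gamma>) = curve_length g \<gamma>"
proof -
  have \<gamma>: "valid_path \<gamma>" "path_image \<gamma> \<subseteq> C" "pathstart \<gamma> = p" "pathfinish \<gamma> = q"
    "speed g \<gamma> integrable_on {0..1}"
    using assms by (auto simp: curves_between_def)
  obtain S where S: "finite S"
    "\<And>t. t \<in> {0..1} - S \<Longrightarrow> (\<gamma> has_vector_derivative vector_derivative \<gamma> (at t)) (at t)"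
    using valid_path_has_vector_derivative[OF \<gamma>(1)] by blast
  have "(speed g \<gamma> has_integral curve_length g \<gamma>) {0..1}"
    using \<gamma>(5) by (simp add: curve_length_def has_integral_integral)
  from has_integral_affinity01[OF this, of "-1" 1]
  have 1: "((\<lambda>t. speed g \<gamma> (1 - t)) has_integral curve_length g \<gamma>) {0..1}"
    by simp
  have "(speed g (reversepath \<gamma>) has_integral curve_length g \<gamma>) {0..1}"
  proof (rule has_integral_spike_finite[OF _ _ 1])
    show "finite ((\<lambda>t. 1 - t) ` S)" using S by simp
    fix t :: real assume t: "t \<in> {0..1} - (\<lambda>t. 1 - t) ` S"
    then have "1 - t \<in> {0..1} - S"
      by (auto simp: image_iff)
    from speed_affine[of \<gamma> _ "-1" t 1] S(2)[OF this]
    show "speed g (reversepath \<gamma>) t = speed g \<gamma> (1 - t)"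
      by (simp add: reversepath_def)
  qed
  then have "speed g (reversepath \<gamma>) integrable_on {0..1}"
    "curve_length g (reversepath \<gamma>) = curve_length g \<gamma>"
    by (auto simp: curve_length_def integral_unique)
  then show "reversepath \<gamma> \<in> curves_between g C q p" "curve_length g (reversepath \<gamma>) = curve_length g \<gamma>"
    using \<gamma> valid_path_imp_reverse[of \<gamma>] by (auto simp: curves_between_def)
qed

lemma curves_between_join:
  assumes "\<gamma>1 \<in> curves_between g C p q" "\<gamma>2 \<in> curves_between g C q r"
  shows "\<gamma>1 +++ \<gamma>2 \<in> curves_between g C p r"
    "curve_length g (\<gamma>1 +++ \<gamma>2) = curve_length g \<gamma>1 + curve_length g \<gamma>2"
proof -
  have \<gamma>1: "valid_path \<gamma>1" "path_image \<gamma>1 \<subseteq> C" "pathstart \<gamma>1 = p" "pathfinish \<gamma>1 = q"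
    "speed g \<gamma>1 integrable_on {0..1}"
    using assms(1) by (auto simp: curves_between_def)
  have \<gamma>2: "valid_path \<gamma>2" "path_image \<gamma>2 \<subseteq> C" "pathstart \<gamma>2 = q" "pathfinish \<gamma>2 = r"
    "speed g \<gamma>2 integrable_on {0..1}"
    using assms(2) by (auto simp: curves_between_def)
  obtain S1 where S1: "finite S1"
    "\<And>t. t \<in> {0..1} - S1 \<Longrightarrow> (\<gamma>1 has_vector_derivative vector_derivative \<gamma>1 (at t)) (at t)"
    using valid_path_has_vector_derivative[OF \<gamma>1(1)] by blast
  obtain S2 where S2: "finite S2"
    "\<And>t. t \<in> {0..1} - S2 \<Longrightarrow> (\<gamma>2 has_vector_derivative vector_derivative \<gamma>2 (at t)) (at t)"
    using valid_path_has_vector_derivative[OF \<gamma>2(1)] by blast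
  have "(speed g \<gamma>1 has_integral curve_length g \<gamma>1) {0..1}"
    using \<gamma>1(5) by (simp add: curve_length_def has_integral_integral)
  from has_integral_affinity01[OF this, of 2 0, THEN has_integral_cmul[where c=2]]
  have 1: "((\<lambda>t. 2 * speed g \<gamma>1 (2*t)) has_integral curve_length g \<gamma>1) {0..1/2}"
    by (simp_all only: image_affinity_atLeastAtMost_div_diff, simp_all)
  have "(speed g \<gamma>2 has_integral curve_length g \<gamma>2) {0..1}"
    using \<gamma>2(5) by (simp add: curve_length_def has_integral_integral)
  from has_integral_affinity01[OF this, of 2 "-1", THEN has_integral_cmul[where c=2]]
  have 2: "((\<lambda>t. 2 * speed g \<gamma>2 (2*t - 1)) has_integral curve_length g \<gamma>2) {1/2..1}"
    by (simp_all only: image_affinity_atLeastAtMost_div_diff, simp_all)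
  have I1: "(speed g (\<gamma>1 +++ \<gamma>2) has_integral curve_length g \<gamma>1) {0..1/2}"
  proof (rule has_integral_spike_finite[OF _ _ 1])
    show "finite (insert (1/2) ((*) 2 -` S1))"
      using S1(1) by (force intro: finite_vimageI[where h = "(*) 2"] inj_onI)
    fix t :: real assume t: "t \<in> {0..1/2} - insert (1/2) ((*) 2 -` S1)"
    then have d: "(\<gamma>1 has_vector_derivative vector_derivative \<gamma>1 (at (2*t))) (at (2*t+0))"
      using S1(2)[of "2*t"] by auto
    have "speed g (\<gamma>1 +++ \<gamma>2) t = speed g (\<lambda>s. \<gamma>1 (2 * s + 0)) t"
      by (rule speed_cong[where e="\<bar>1/2 - t\<bar>", OF _ _ has_vector_derivative_affine[OF d]])
        (use t in \<open>auto simp: joinpaths_def\<close>)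
    then show "speed g (\<gamma>1 +++ \<gamma>2) t = 2 * speed g \<gamma>1 (2*t)"
      using speed_affine[OF d] by simp
  qed
  have I2: "(speed g (\<gamma>1 +++ \<gamma>2) has_integral curve_length g \<gamma>2) {1/2..1}"
  proof (rule has_integral_spike_finite[OF _ _ 2])
    show "finite (insert (1/2) ((\<lambda>t. 2 * t - 1) -` S2))"
      using S2(1) by (force intro: finite_vimageI[where h = "\<lambda>t. 2 * t - 1"] inj_onI)
    fix t :: real assume t: "t \<in> {1/2..1} - insert (1/2) ((\<lambda>t. 2 * t - 1) -` S2)"
    then have d: "(\<gamma>2 has_vector_derivative vector_derivative \<gamma>2 (at (2*t-1))) (at (2*t+(-1)))"
      using S2(2)[of "2*t-1"] by auto
    have "speed g (\<gamma>1 +++ \<gamma>2) t = speed g (\<lambda>s. \<gamma>2 (2 * s + (-1))) t"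
      by (rule speed_cong[where e="\<bar>1/2 - t\<bar>", OF _ _ has_vector_derivative_affine[OF d]])
        (use t in \<open>auto simp: joinpaths_def\<close>)
    then show "speed g (\<gamma>1 +++ \<gamma>2) t = 2 * speed g \<gamma>2 (2*t-1)"
      using speed_affine[OF d] by simp
  qed
  have "(speed g (\<gamma>1 +++ \<gamma>2) has_integral curve_length g \<gamma>1 + curve_length g \<gamma>2) {0..1}"
    by (rule has_integral_combine[OF _ _ I1 I2]) auto
  then have "speed g (\<gamma>1 +++ \<gamma>2) integrable_on {0..1}"
    "curve_length g (\<gamma>1 +++ \<gamma>2) = curve_length g \<gamma>1 + curve_length g \<gamma>2"
    by (auto simp: curve_length_def integral_unique)
  then show "\<gamma>1 +++ \<gamma>2 \<in> curves_between g C p r"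
    "curve_length g (\<gamma>1 +++ \<gamma>2) = curve_length g \<gamma>1 + curve_length g \<gamma>2"
    using \<gamma>1 \<gamma>2 valid_path_join[of \<gamma>1 \<gamma>2] path_image_join_subset[of \<gamma>1 \<gamma>2]
    by (auto simp: curves_between_def)
qed

lemma curves_between_const:
  assumes "p \<in> C"
  shows "(\<lambda>t. p) \<in> curves_between g C p p" "curve_length g (\<lambda>t. p) = 0"
proof -
  have "g p 0 0 = 0"
    using quadratic[of p 0 0] by simp
  then have "speed g (\<lambda>t. p) = (\<lambda>t. 0)"
    by (simp add: speed_def fun_eq_iff)
  moreover have "valid_path (\<lambda>t. p)"
    unfolding valid_path_def by (intro C1_differentiable_imp_piecewise) auto
  ultimately show "(\<lambda>t. p) \<in> curves_between g C p p" "curve_length g (\<lambda>t. p) = 0"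
    using assms by (auto simp: curves_between_def curve_length_def path_image_def pathstart_def pathfinish_def)
qed

text \<open>A C1 arc on any parameter interval gives, after an affine reparametrisation, an
  admissible curve on the unit interval.\<close>

lemma C1_arc_curve:
  assumes "a < b" and d: "\<And>t. t \<in> {a..b} \<Longrightarrow> (c has_vector_derivative c' t) (at t)"
    and c': "continuous_on {a..b} c'" and C: "c ` {a..b} \<subseteq> C"
    and cont: "continuous_on {a..b} (\<lambda>t. g (c t) (c' t) (c' t))"
    and bound: "\<And>t. t \<in> {a..b} \<Longrightarrow> g (c t) (c' t) (c' t) \<le> M\<^sup>2" and "0 \<le> M"
  obtains \<gamma> where "\<gamma> \<in> curves_between g C (c a) (c b)" "curve_length g \<gamma> \<le> M * (b - a)"
proof -
  define l where "l t = (b - a) * t + a" for t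
  define \<gamma> where "\<gamma> = (\<lambda>t. c (l t))"
  have l: "l t \<in> {a..b}" if "t \<in> {0..1}" for t
  proof -
    have "0 \<le> (b - a) * t" "(b - a) * t \<le> (b - a) * 1"
      using that \<open>a < b\<close> by (intro mult_nonneg_nonneg mult_left_mono; simp)+
    then show ?thesis by (auto simp: l_def)
  qed
  have l_cont: "continuous_on {0..1} l"
    unfolding l_def by (intro continuous_intros)
  have \<gamma>_deriv: "(\<gamma> has_vector_derivative (b - a) *\<^sub>R c' (l t)) (at t)" if "t \<in> {0..1}" for t
    using has_vector_derivative_affine[of c "c' (l t)" "b - a" t a] d[OF l[OF that]]
    by (simp add: \<gamma>_def l_def)
  have sp: "speed g \<gamma> t = (b - a) * sqrt (g (c (l t)) (c' (l t)) (c' (l t)))" if "t \<in> {0..1}" for t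
    unfolding speed_def vector_derivative_at[OF \<gamma>_deriv[OF that]] quadratic
    using \<open>a < b\<close> by (simp add: real_sqrt_mult \<gamma>_def)
  have "continuous_on {0..1} (\<lambda>t. (b - a) * sqrt (g (c (l t)) (c' (l t)) (c' (l t))))"
    by (intro continuous_intros continuous_on_compose2[OF cont l_cont]) (use l in auto)
  then have scont: "continuous_on {0..1} (speed g \<gamma>)"
    by (rule continuous_on_eq) (rule sp[symmetric])
  then have int: "speed g \<gamma> integrable_on {0..1}"
    by (rule integrable_continuous_real)
  have "valid_path \<gamma>"
    unfolding valid_path_def
  proof (rule C1_differentiable_imp_piecewise)
    have "continuous_on {0..1} (\<lambda>t. (b - a) *\<^sub>R c' (l t))"
      by (intro continuous_intros continuous_on_compose2[OF c' l_cont]) (use l in auto)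
    with \<gamma>_deriv show "\<gamma> C1_differentiable_on {0..1}"
      unfolding C1_differentiable_on_def
      by (intro exI[of _ "\<lambda>t. (b - a) *\<^sub>R c' (l t)"] conjI ballI)
  qed
  moreover have "path_image \<gamma> \<subseteq> C"
    using C l by (auto simp: path_image_def \<gamma>_def)
  ultimately have "\<gamma> \<in> curves_between g C (c a) (c b)"
    using int by (auto simp: curves_between_def pathstart_def pathfinish_def \<gamma>_def l_def)
  moreover have "curve_length g \<gamma> \<le> M * (b - a)"
  proof -
    have "speed g \<gamma> t \<le> M * (b - a)" if "t \<in> {0..1}" for t
      using sp[OF that] real_sqrt_le_mono[OF bound[OF l[OF that]]] \<open>0 \<le> M\<close> \<open>a < b\<close>
      by (simp add: mult.commute)
    then have "integral {0..1} (speed g \<gamma>) \<le> integral {0..1::real} (\<lambda>t. M * (b - a))"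
      by (intro integral_le int integrable_const_ivl)
    then show ?thesis by (simp add: curve_length_def)
  qed
  ultimately show thesis by (rule that)
qed

end

text \<open>A function along a curve whose derivative is controlled by the speed varies by at most a
  multiple of the length. Exceptional parameters, where the speed is an arbitrary value, do not
  influence the integrals.\<close>

lemma variation_le_curve_length:
  fixes u :: "real \<Rightarrow> 'b::euclidean_space"
  assumes \<gamma>: "speed g \<gamma> integrable_on {0..1}" and s: "s \<in> {0..1}" and "0 \<le> K"
    and u: "continuous_on {0..s} u" and S: "finite S"
    and nonneg: "\<And>t. t \<in> {0..1} - S \<Longrightarrow> 0 \<le> speed g \<gamma> t"
    and deriv: "\<And>t. t \<in> {0..s} - S \<Longrightarrow> (u has_vector_derivative u' t) (at t)"
    and bound: "\<And>t. t \<in> {0..s} - S \<Longrightarrow> norm (u' t) \<le> K * speed g \<gamma> t"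
  shows "norm (u s - u 0) \<le> K * curve_length g \<gamma>"
proof -
  define sp where "sp t = (if t \<in> S then 0 else speed g \<gamma> t)" for t
  define w where "w t = (if t \<in> S then 0 else u' t)" for t
  have sp01: "(sp has_integral curve_length g \<gamma>) {0..1}"
    using has_integral_spike_finite[OF S, of "{0..1}" sp "speed g \<gamma>" "curve_length g \<gamma>"]
      has_integral_integral[THEN iffD1, OF \<gamma>]
    by (auto simp: curve_length_def sp_def)
  have sp: "sp integrable_on {0..s}"
    by (rule integrable_on_subinterval[OF has_integral_integrable[OF sp01]]) (use s in auto)
  have Ksp: "(\<lambda>t. K * sp t) integrable_on {0..s}"
    using integrable_cmul[OF sp, of K] by simp
  have "(w has_integral (u s - u 0)) {0..s}"
    by (rule fundamental_theorem_of_calculus_interior_strong[OF S _ _ u])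
      (use s deriv in \<open>auto simp: w_def\<close>)
  then have w: "w integrable_on {0..s}" and "norm (u s - u 0) = norm (integral {0..s} w)"
    by (auto simp: integral_unique)
  note this(2)
  also have "\<dots> \<le> integral {0..s} (\<lambda>t. K * sp t)"
    by (rule integral_norm_bound_integral[OF w Ksp])
      (use bound in \<open>auto simp: w_def sp_def\<close>)
  also have "integral {0..s} (\<lambda>t. K * sp t) = K * integral {0..s} sp"
    by simp
  also have "K * integral {0..s} sp \<le> K * integral {0..1} sp"
  proof (intro mult_left_mono integral_subset_le sp \<open>0 \<le> K\<close>)
    show "sp integrable_on {0..1}" using sp01 by (rule has_integral_integrable)
  qed (use s \<open>0 \<le> K\<close> nonneg in \<open>auto simp: sp_def\<close>)
  also have "integral {0..1} sp = curve_length g \<gamma>"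
    using sp01 by (rule integral_unique)
  finally show ?thesis .
qed

section \<open>Central projection onto the level set\<close>

context symmetric_trilinear
begin

text \<open>Since \<open>6 * T p v w\<close> is the Hessian of \<open>x \<mapsto> T x x x\<close>, this is the centroaffine metric
  of that cubic.\<close>

definition metric :: "'a \<Rightarrow> 'a \<Rightarrow> 'a \<Rightarrow> real"
  where "metric p v w = - 2 * T p v w"

definition level_set :: "'a set"
  where "level_set = {x. T x x x = 1}"

definition central_projection :: "'a \<Rightarrow> 'a"
  where "central_projection x = (T x x x) powr (-1/3) *\<^sub>R x"

definition projection_derivative :: "'a \<Rightarrow> 'a \<Rightarrow> 'a"
  where "projection_derivative x d =
    (T x x x) powr (-1/3) *\<^sub>R d - ((T x x x) powr (-4/3) * T x x d) *\<^sub>R x"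

lemma central_projection_in_level_set:
  assumes "T x x x > 0"
  shows "central_projection x \<in> level_set"
proof -
  have "((T x x x) powr (-1/3)) ^ 3 = (T x x x) powr (-1)"
    using assms by (simp add: powr_realpow[symmetric] powr_powr)
  then have "((T x x x) powr (-1/3)) ^ 3 * T x x x = 1"
    using assms by (simp add: powr_minus)
  then show ?thesis
    by (simp add: central_projection_def level_set_def trilinear_simps power3_eq_cube mult_ac)
qed

lemma central_projection_id: "x \<in> level_set \<Longrightarrow> central_projection x = x"
  by (simp add: central_projection_def level_set_def)

lemma projection_derivative_scale:
  "projection_derivative x (a *\<^sub>R d) = a *\<^sub>R projection_derivative x d"
  by (simp add: projection_derivative_def trilinear_simps algebra_simps)

text \<open>By symmetry the derivative of \<open>x \<mapsto> T x x x\<close> in direction \<open>d\<close> is \<open>3 * T x x d\<close>; the factor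
  3 cancels against the exponent.\<close>

lemma central_projection_has_vector_derivative:
  assumes c: "(c has_vector_derivative c') (at t)" and pos: "T (c t) (c t) (c t) > 0"
  shows "((\<lambda>s. central_projection (c s)) has_vector_derivative projection_derivative (c t) c')
    (at (t::real))"
proof -
  have "((\<lambda>s. T (c s) (c s) (c s)) has_real_derivative 3 * T (c t) (c t) c') (at t)"
    using has_vector_derivative_T[OF c c c]
    by (simp add: swap_last_to_first[of c'] swap23[of "c t" c'])
  from DERIV_fun_powr[OF this pos, of "-1/3"]
  have "((\<lambda>s. T (c s) (c s) (c s) powr (-1/3)) has_real_derivative
      - (T (c t) (c t) (c t) powr (-4/3) * T (c t) (c t) c')) (at t)"
    by (simp add: mult.assoc)
  from has_vector_derivative_scaleR[OF this c]
  show ?thesis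
    by (simp add: central_projection_def projection_derivative_def)
qed

lemma continuous_on_central_projection:
  assumes "continuous_on S f" "\<And>s. s \<in> S \<Longrightarrow> T (f s) (f s) (f s) > 0"
  shows "continuous_on S (\<lambda>s. central_projection (f s))"
  unfolding central_projection_def using assms by (intro continuous_intros) force+

lemma continuous_on_projection_derivative:
  assumes "continuous_on S f" "continuous_on S k" "\<And>s. s \<in> S \<Longrightarrow> T (f s) (f s) (f s) > 0"
  shows "continuous_on S (\<lambda>s. projection_derivative (f s) (k s))"
  unfolding projection_derivative_def using assms by (intro continuous_intros) force+

lemma metric_quadratic: "metric p (a *\<^sub>R v) (a *\<^sub>R v) = a\<^sup>2 * metric p v v"
  by (simp add: metric_def trilinear_simps power2_eq_square)

sublocale quadratic_speed metric
  by standard (rule metric_quadratic)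

text \<open>Nearby points of the level set are joined by the central projection of a straight segment.
  One constant \<open>M\<close> serves for all of them, because the squared speed is a quadratic form in the
  direction of the segment whose coefficients depend continuously on the base point, hence is
  bounded on (small closed ball) \<open>\<times>\<close> (unit sphere). The arcs live in the level set and not in a
  given hypersurface, so that they can also be drawn towards a boundary point of the
  hypersurface.\<close>

lemma local_arcs:
  assumes x: "x \<in> level_set" and "e > 0"
  obtains r M where "r > 0" "M \<ge> 0"
    "\<And>y z. y \<in> ball x r \<inter> level_set \<Longrightarrow> z \<in> ball x r \<inter> level_set \<Longrightarrow>
      \<exists>c c'. c 0 = y \<and> c 1 = z \<and>
        (\<forall>t\<in>{0..1}. (c has_vector_derivative c' t) (at t) \<and> c t \<in> ball x e \<inter> level_set \<and>
           metric (c t) (c' t) (c' t) \<le> (M * norm (z - y))\<^sup>2) \<and>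
        continuous_on {0..1::real} c'"
proof -
  let ?P = "{y. T y y y > 0}"
  have opP: "open ?P"
    by (intro open_Collect_less continuous_intros)
  have "open (?P \<inter> central_projection -` ball x e)"
    by (intro continuous_open_preimage continuous_on_central_projection[OF continuous_on_id] opP) auto
  moreover have "x \<in> ?P \<inter> central_projection -` ball x e"
    using x \<open>e > 0\<close> by (simp add: central_projection_id) (simp add: level_set_def)
  ultimately obtain r where r: "r > 0" "cball x r \<subseteq> ?P \<inter> central_projection -` ball x e"
    unfolding open_contains_cball by blast
  define Q where "Q y d = metric (central_projection y) (projection_derivative y d) (projection_derivative y d)"
    for y d
  have "continuous_on (cball x r \<times> sphere 0 1) (\<lambda>(y, d). Q y d)"
    unfolding Q_def metric_def case_prod_beta
    by (intro continuous_intros continuous_on_central_projection continuous_on_projection_derivative)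
      (use r in auto)
  then have "compact ((\<lambda>(y, d). Q y d) ` (cball x r \<times> sphere 0 1))"
    by (intro compact_continuous_image compact_Times) auto
  then have "bounded ((\<lambda>(y, d). Q y d) ` (cball x r \<times> sphere 0 1))"
    by (rule compact_imp_bounded)
  then obtain B where "B > 0" and B: "\<And>y d. y \<in> cball x r \<Longrightarrow> norm d = 1 \<Longrightarrow> \<bar>Q y d\<bar> \<le> B"
    unfolding bounded_pos by (fastforce simp: image_iff)
  have Q: "Q y d \<le> (sqrt B * norm d)\<^sup>2" if "y \<in> cball x r" for y d
  proof (cases "d = 0")
    case True
    then show ?thesis
      using projection_derivative_scale[of y 0 0] metric_quadratic[of _ 0 0]
      by (simp add: Q_def)
  next
    case False
    have "Q y d = Q y (norm d *\<^sub>R (inverse (norm d) *\<^sub>R d))"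
      using False by simp
    also have "\<dots> = (norm d)\<^sup>2 * Q y (inverse (norm d) *\<^sub>R d)"
      unfolding Q_def projection_derivative_scale[of y "norm d"] metric_quadratic ..
    also have "\<dots> \<le> (norm d)\<^sup>2 * B"
      using B[OF that, of "inverse (norm d) *\<^sub>R d"] False by (intro mult_left_mono) auto
    finally show ?thesis
      using \<open>B > 0\<close> by (simp add: power_mult_distrib mult.commute)
  qed
  show thesis
  proof (rule that[OF r(1), of "sqrt B"])
    show "0 \<le> sqrt B" using \<open>B > 0\<close> by simp
    fix y z assume y: "y \<in> ball x r \<inter> level_set" and z: "z \<in> ball x r \<inter> level_set"
    define l where "l t = y + t *\<^sub>R (z - y)" for t :: real
    define c where "c t = central_projection (l t)" for t
    define c' where "c' t = projection_derivative (l t) (z - y)" for t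
    have l: "l t \<in> cball x r" if "t \<in> {0..1}" for t
    proof -
      have "l t = (1 - t) *\<^sub>R y + t *\<^sub>R z" by (simp add: l_def algebra_simps)
      then show ?thesis
        using convexD[OF convex_cball, of y x r z "1 - t" t] y z that by auto
    qed
    have l': "(l has_vector_derivative (z - y)) (at t)" for t
      unfolding l_def by (auto intro!: derivative_eq_intros)
    have "(c has_vector_derivative c' t) (at t) \<and> c t \<in> ball x e \<inter> level_set \<and>
           metric (c t) (c' t) (c' t) \<le> (sqrt B * norm (z - y))\<^sup>2" if "t \<in> {0..1}" for t
    proof (intro conjI)
      have pos: "T (l t) (l t) (l t) > 0" and e: "central_projection (l t) \<in> ball x e"
        using l[OF that] r(2) by auto
      show "(c has_vector_derivative c' t) (at t)"
        unfolding c_def c'_def by (rule central_projection_has_vector_derivative[OF l' pos])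
      show "c t \<in> ball x e \<inter> level_set"
        using e central_projection_in_level_set[OF pos] by (simp add: c_def)
      show "metric (c t) (c' t) (c' t) \<le> (sqrt B * norm (z - y))\<^sup>2"
        using Q[OF l[OF that], of "z - y"] by (simp add: Q_def c_def c'_def)
    qed
    moreover have "continuous_on {0..1} c'"
      unfolding c'_def
    proof (rule continuous_on_projection_derivative)
      show "continuous_on {0..1} l" unfolding l_def by (intro continuous_intros)
      show "\<And>s. s \<in> {0..1} \<Longrightarrow> 0 < T (l s) (l s) (l s)"
        using subsetD[OF r(2), OF l] by simp
    qed (rule continuous_on_const)
    moreover have "c 0 = y" "c 1 = z"
      using y z by (auto simp: c_def l_def central_projection_id)
    ultimately have "c 0 = y \<and> c 1 = z \<and>
        (\<forall>t\<in>{0..1}. (c has_vector_derivative c' t) (at t) \<and> c t \<in> ball x e \<inter> level_set \<and>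
           metric (c t) (c' t) (c' t) \<le> (sqrt B * norm (z - y))\<^sup>2) \<and>
        continuous_on {0..1} c'"
      by (intro conjI ballI) auto
    then show "\<exists>c c'. c 0 = y \<and> c 1 = z \<and>
        (\<forall>t\<in>{0..1}. (c has_vector_derivative c' t) (at t) \<and> c t \<in> ball x e \<inter> level_set \<and>
           metric (c t) (c' t) (c' t) \<le> (sqrt B * norm (z - y))\<^sup>2) \<and>
        continuous_on {0..1::real} c'"
      by (intro exI)
  qed
qed

end

section \<open>The Riemannian distance of a hyperbolic piece of a cubic level set\<close>

text \<open>The tangent space at \<open>p\<close> is the kernel of \<open>T p p\<close>, the differential of the cubic at
  \<open>p\<close> up to a factor.\<close>

locale special_real_hypersurface = symmetric_trilinear T
  for T :: "'a::euclidean_space \<Rightarrow> 'a \<Rightarrow> 'a \<Rightarrow> real" +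
  fixes H :: "'a set"
  assumes open_in_level_set: "openin (top_of_set level_set) H"
    and negative_on_tangent: "\<lbrakk>p \<in> H; T p p v = 0; v \<noteq> 0\<rbrakk> \<Longrightarrow> T p v v < 0"
begin

lemma H_subset_level_set: "H \<subseteq> level_set"
  using open_in_level_set by (rule openin_imp_subset)

lemma H_level: "p \<in> H \<Longrightarrow> T p p p = 1"
  using H_subset_level_set by (auto simp: level_set_def)

lemma metric_nonneg:
  assumes "p \<in> H" "T p p v = 0"
  shows "0 \<le> metric p v v"
  using negative_on_tangent[OF assms] by (cases "v = 0") (auto simp: metric_def)

lemma H_contains_ball:
  assumes "x \<in> H"
  obtains e where "e > 0" "ball x e \<inter> level_set \<subseteq> H"
  using open_in_level_set assms unfolding openin_contains_ball by blast

text \<open>At the exceptional parameters the speed of a piecewise C1 path is an arbitrary number,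
  possibly negative; the finite set \<open>S\<close> collects them together with the endpoints.\<close>

lemma velocity_tangent:
  assumes "\<gamma> \<in> curves_between metric C p q" "C \<subseteq> H"
  obtains S v where "finite S"
    "\<And>t. t \<in> {0..1} - S \<Longrightarrow> (\<gamma> has_vector_derivative v t) (at t)"
    "\<And>t. t \<in> {0..1} - S \<Longrightarrow> T (\<gamma> t) (\<gamma> t) (v t) = 0"
    "\<And>t. t \<in> {0..1} - S \<Longrightarrow> speed metric \<gamma> t = sqrt (metric (\<gamma> t) (v t) (v t))"
proof -
  have \<gamma>: "valid_path \<gamma>" "path_image \<gamma> \<subseteq> H"
    using assms by (auto simp: curves_between_def)
  obtain S where S: "finite S"
    "\<And>t. t \<in> {0..1} - S \<Longrightarrow> (\<gamma> has_vector_derivative vector_derivative \<gamma> (at t)) (at t)"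
    using valid_path_has_vector_derivative[OF \<gamma>(1)] by blast
  have "T (\<gamma> t) (\<gamma> t) (vector_derivative \<gamma> (at t)) = 0" if t: "t \<in> {0..1} - (S \<union> {0,1})" for t
  proof -
    let ?v = "vector_derivative \<gamma> (at t)"
    have v: "(\<gamma> has_vector_derivative ?v) (at t)" using S t by auto
    have 1: "((\<lambda>s. T (\<gamma> s) (\<gamma> s) (\<gamma> s)) has_real_derivative 3 * T (\<gamma> t) (\<gamma> t) ?v) (at t)"
      using has_vector_derivative_T[OF v v v]
      by (simp add: swap_last_to_first[of ?v] swap23[of "\<gamma> t" ?v])
    have 2: "T (\<gamma> s) (\<gamma> s) (\<gamma> s) = 1" if "s \<in> {0<..<1}" for s
      using \<gamma>(2) that by (intro H_level) (auto simp: path_image_def image_subset_iff)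
    have "((\<lambda>s. 1) has_real_derivative 3 * T (\<gamma> t) (\<gamma> t) ?v) (at t)"
      by (rule has_field_derivative_transform_within_open[OF 1, of "{0<..<1}"]) (use t 2 in auto)
    from DERIV_unique[OF this DERIV_const] show ?thesis by simp
  qed
  then show thesis
    using S by (intro that[of "S \<union> {0,1}" "\<lambda>t. vector_derivative \<gamma> (at t)"]) (auto simp: speed_def)
qed

text \<open>At a point \<open>x\<close> of the level set this is one third of minus the Hessian of the logarithm of
  the cubic. It agrees with the metric on tangent vectors, takes the value 1 on the position vector
  \<open>x\<close>, and makes the two orthogonal. Thus it extends the metric to a positive definite form on the
  ambient space, and the forms at different points of \<open>H\<close> can be compared on one and the
  same vector.\<close>

definition full_form :: "'a \<Rightarrow> 'a \<Rightarrow> real"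
  where "full_form x v = - 2 * T x v v + 3 * (T x x v)\<^sup>2"

lemma full_form_scale: "full_form x (a *\<^sub>R v) = a\<^sup>2 * full_form x v"
  by (simp add: full_form_def trilinear_simps power2_eq_square algebra_simps)

lemma continuous_on_full_form:
  assumes "continuous_on S f" "continuous_on S k"
  shows "continuous_on S (\<lambda>x. full_form (f x) (k x))"
  unfolding full_form_def by (intro continuous_intros assms)

lemma tangential_part:
  assumes "p \<in> H"
  shows "T p p (v - T p p v *\<^sub>R p) = 0"
  using assms by (simp add: trilinear_simps H_level)

lemma full_form_split:
  assumes "p \<in> H"
  shows "full_form p v = (T p p v)\<^sup>2 + metric p (v - T p p v *\<^sub>R p) (v - T p p v *\<^sub>R p)"
  using assms swap23[of p v p]
  by (simp add: full_form_def metric_def trilinear_simps H_level power2_eq_square algebra_simps)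

lemma full_form_pos:
  assumes "p \<in> H" "v \<noteq> 0"
  shows "full_form p v > 0"
proof (cases "T p p v = 0")
  case True
  with assms negative_on_tangent[of p v] show ?thesis
    by (simp add: full_form_def)
next
  case False
  then have "(T p p v)\<^sup>2 > 0" by simp
  with metric_nonneg[OF assms(1) tangential_part[OF assms(1)], of v] show ?thesis
    unfolding full_form_split[OF assms(1)] by (rule add_pos_nonneg[rotated])
qed

text \<open>Positive definiteness at \<open>x\<close> persists, with a uniform constant, on a neighbourhood of
  \<open>x\<close> in the ambient space, because the unit sphere is compact.\<close>

lemma full_form_lower_bound:
  assumes "x \<in> H"
  obtains k e where "k > 0" "e > 0"
    "\<And>z v. z \<in> cball x e \<Longrightarrow> k * (norm v)\<^sup>2 \<le> full_form z v"
proof -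
  have "continuous_on (sphere 0 1) (full_form x)"
    by (intro continuous_on_full_form continuous_intros)
  from continuous_attains_inf[OF compact_sphere _ this]
  obtain v0 where v0: "norm v0 = 1" "\<And>v. norm v = 1 \<Longrightarrow> full_form x v0 \<le> full_form x v"
    by (auto simp: sphere_eq_empty)
  define m where "m = full_form x v0"
  have "m > 0"
    unfolding m_def using v0 by (intro full_form_pos assms) auto
  have "continuous_on (cball x 1 \<times> sphere 0 1) (\<lambda>w. full_form (fst w) (snd w))"
    by (intro continuous_on_full_form continuous_intros)
  then have "uniformly_continuous_on (cball x 1 \<times> sphere 0 1) (\<lambda>w. full_form (fst w) (snd w))"
    by (intro compact_uniformly_continuous compact_Times) auto
  then obtain d where "d > 0" and d: "\<And>w w'. w \<in> cball x 1 \<times> sphere 0 1 \<Longrightarrow>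
      w' \<in> cball x 1 \<times> sphere 0 1 \<Longrightarrow> dist w' w < d \<Longrightarrow>
      dist (full_form (fst w') (snd w')) (full_form (fst w) (snd w)) < m / 2"
    using \<open>m > 0\<close> unfolding uniformly_continuous_on_def by (metis half_gt_zero)
  show thesis
  proof (rule that[of "m / 2" "min 1 (d / 2)"])
    fix z v assume z: "z \<in> cball x (min 1 (d / 2))"
    have unit: "m / 2 \<le> full_form z v" if "norm v = 1" for v
    proof -
      have "dist (full_form z v) (full_form x v) < m / 2"
        using d[of "(x, v)" "(z, v)"] z that \<open>d > 0\<close>
        by (simp add: dist_Pair_Pair dist_commute)
      moreover have "m \<le> full_form x v"
        using v0(2)[OF that] by (simp add: m_def)
      ultimately show ?thesis
        by (simp add: dist_real_def abs_if split: if_splits)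
    qed
    show "m / 2 * (norm v)\<^sup>2 \<le> full_form z v"
    proof (cases "v = 0")
      case True
      then show ?thesis by (simp add: full_form_def)
    next
      case False
      have "full_form z v = full_form z (norm v *\<^sub>R (inverse (norm v) *\<^sub>R v))"
        using False by simp
      also have "\<dots> = (norm v)\<^sup>2 * full_form z (inverse (norm v) *\<^sub>R v)"
        by (rule full_form_scale)
      finally show ?thesis
        using unit[of "inverse (norm v) *\<^sub>R v"] False
        by (simp add: mult.commute)
    qed
  qed (use \<open>m > 0\<close> \<open>d > 0\<close> in auto)
qed

text \<open>The speed is nonnegative only off a finite set, so the bound is read off from the variation of
  a constant function.\<close>

lemma curve_length_nonneg:
  assumes "\<gamma> \<in> curves_between metric C p q" "C \<subseteq> H"
  shows "0 \<le> curve_length metric \<gamma>"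
proof -
  have H: "\<gamma> t \<in> H" if "t \<in> {0..1}" for t
    using assms that by (auto simp: curves_between_def path_image_def image_subset_iff subset_iff)
  obtain S v where S: "finite S"
    "\<And>t. t \<in> {0..1} - S \<Longrightarrow> T (\<gamma> t) (\<gamma> t) (v t) = 0"
    "\<And>t. t \<in> {0..1} - S \<Longrightarrow> speed metric \<gamma> t = sqrt (metric (\<gamma> t) (v t) (v t))"
    by (rule velocity_tangent[OF assms]) blast
  have "norm ((0::real) - 0) \<le> 1 * curve_length metric \<gamma>"
  proof (rule variation_le_curve_length[where u="\<lambda>_. 0" and u'="\<lambda>_. 0" and s=1 and S=S])
    show "speed metric \<gamma> integrable_on {0..1}"
      using assms by (simp add: curves_between_def)
    show nonneg: "0 \<le> speed metric \<gamma> t" if "t \<in> {0..1} - S" for t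
      using S(2,3)[OF that] metric_nonneg[OF H, of t] that by simp
    then show "norm (0::real) \<le> 1 * speed metric \<gamma> t" if "t \<in> {0..1} - S" for t
      using that by simp
  qed (use S in auto)
  then show ?thesis by simp
qed

text \<open>Up to the first parameter \<open>s\<close> at which the curve is as far from \<open>x\<close> as the smaller of
  \<open>dist x y\<close> and \<open>e\<close>, it stays where the metric dominates \<open>k\<close> times the Euclidean one.\<close>

lemma curve_length_lower_bound:
  assumes \<gamma>: "\<gamma> \<in> curves_between metric C x y" and C: "C \<subseteq> H" and "k > 0" "e > 0"
    and k: "\<And>z v. z \<in> cball x e \<Longrightarrow> k * (norm v)\<^sup>2 \<le> full_form z v"
  shows "sqrt k * min (dist x y) e \<le> curve_length metric \<gamma>"
proof -
  define r where "r = min (dist x y) e"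
  have \<gamma>': "valid_path \<gamma>" "path_image \<gamma> \<subseteq> H" "\<gamma> 0 = x" "\<gamma> 1 = y" "speed metric \<gamma> integrable_on {0..1}"
    using \<gamma> C by (auto simp: curves_between_def pathstart_def pathfinish_def)
  have cont: "continuous_on {0..1} \<gamma>"
    using valid_path_imp_path[OF \<gamma>'(1)] by (simp add: path_def)
  have H: "\<gamma> t \<in> H" if "t \<in> {0..1}" for t
    using \<gamma>' that by (auto simp: path_image_def)
  define K where "K = {t \<in> {0..1}. r \<le> dist x (\<gamma> t)}"
  have "closed K"
    unfolding K_def by (intro continuous_on_closed_Collect_le continuous_intros cont)
  moreover have "bounded K"
    by (rule bounded_subset[of "{0..1}"]) (auto simp: K_def)
  ultimately have "compact K" by (simp add: compact_eq_bounded_closed)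
  moreover have "1 \<in> K" by (simp add: K_def r_def \<gamma>')
  ultimately obtain s where s: "s \<in> K" "\<And>t. t \<in> K \<Longrightarrow> s \<le> t"
    using compact_attains_inf[of K] by blast
  then have s01: "s \<in> {0..1}" by (simp add: K_def)
  have before: "\<gamma> t \<in> cball x e" if "t \<in> {0..s} - {s}" for t
  proof -
    have "t \<notin> K" using s(2)[of t] that by auto
    then have "dist x (\<gamma> t) < r" using that s01 by (auto simp: K_def)
    then show ?thesis by (simp add: r_def)
  qed
  obtain S v where S: "finite S"
    "\<And>t. t \<in> {0..1} - S \<Longrightarrow> (\<gamma> has_vector_derivative v t) (at t)"
    "\<And>t. t \<in> {0..1} - S \<Longrightarrow> T (\<gamma> t) (\<gamma> t) (v t) = 0"
    "\<And>t. t \<in> {0..1} - S \<Longrightarrow> speed metric \<gamma> t = sqrt (metric (\<gamma> t) (v t) (v t))"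
    by (rule velocity_tangent[OF \<gamma> C], rule that)
  have "norm (\<gamma> s - \<gamma> 0) \<le> (1 / sqrt k) * curve_length metric \<gamma>"
  proof (rule variation_le_curve_length[OF \<gamma>'(5) s01])
    show "0 \<le> 1 / sqrt k" using \<open>k > 0\<close> by simp
    show "continuous_on {0..s} \<gamma>"
      using continuous_on_subset[OF cont] s01 by auto
    show "finite (insert s S)" using S by simp
    show "0 \<le> speed metric \<gamma> t" if "t \<in> {0..1} - insert s S" for t
      using S(3,4)[of t] metric_nonneg[OF H, of t] that by simp
    fix t assume t: "t \<in> {0..s} - insert s S"
    then have t': "t \<in> {0..1} - S" using s01 by auto
    show "(\<gamma> has_vector_derivative v t) (at t)" using S(2)[OF t'] .
    have "k * (norm (v t))\<^sup>2 \<le> full_form (\<gamma> t) (v t)"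
      using k[OF before] t by auto
    also have "\<dots> = metric (\<gamma> t) (v t) (v t)"
      using S(3)[OF t'] by (simp add: full_form_def metric_def)
    finally have "sqrt (k * (norm (v t))\<^sup>2) \<le> speed metric \<gamma> t"
      using S(4)[OF t'] by simp
    then show "norm (v t) \<le> 1 / sqrt k * speed metric \<gamma> t"
      using \<open>k > 0\<close> by (simp add: real_sqrt_mult field_simps)
  qed
  then have "sqrt k * norm (\<gamma> s - \<gamma> 0) \<le> curve_length metric \<gamma>"
    using \<open>k > 0\<close> by (simp add: field_simps)
  moreover have "r \<le> norm (\<gamma> s - \<gamma> 0)"
    using s(1) by (simp add: K_def \<gamma>' dist_norm norm_minus_commute)
  then have "sqrt k * r \<le> sqrt k * norm (\<gamma> s - \<gamma> 0)"
    using \<open>k > 0\<close> by (intro mult_left_mono) auto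
  ultimately show ?thesis
    unfolding r_def by (rule order_trans[rotated])
qed

end

text \<open>Both inclusions between the Riemannian and the Euclidean topology of a connected component are
  needed: Euclidean limits are Riemannian limits by \<open>short_curves\<close>, and conversely by
  \<open>curve_length_lower_bound\<close>.\<close>

locale special_real_component = special_real_hypersurface +
  fixes C :: "'a set"
  assumes component: "C \<in> components H"
begin

lemma C_subset: "C \<subseteq> H"
  using component by (rule in_components_subset)

lemma C_absorbs: "connected K \<Longrightarrow> K \<subseteq> H \<Longrightarrow> x \<in> K \<Longrightarrow> x \<in> C \<Longrightarrow> K \<subseteq> C"
  using components_maximal[OF component, of K] by blast

lemma short_curves:
  assumes "x \<in> C"
  obtains r M where "r > 0" "M \<ge> 0" "ball x r \<inter> level_set \<subseteq> C"
    "\<And>y z. y \<in> ball x r \<inter> level_set \<Longrightarrow> z \<in> ball x r \<inter> level_set \<Longrightarrow>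
      \<exists>\<gamma>\<in>curves_between metric C y z. curve_length metric \<gamma> \<le> M * dist y z"
proof -
  have x: "x \<in> H" "x \<in> level_set" using assms C_subset H_subset_level_set by auto
  obtain e where e: "e > 0" "ball x e \<inter> level_set \<subseteq> H"
    using H_contains_ball[OF x(1)] by blast
  obtain r M where r: "r > 0" "M \<ge> 0" and
    arc: "\<And>y z. y \<in> ball x r \<inter> level_set \<Longrightarrow> z \<in> ball x r \<inter> level_set \<Longrightarrow>
      \<exists>c c'. c 0 = y \<and> c 1 = z \<and>
        (\<forall>t\<in>{0..1}. (c has_vector_derivative c' t) (at t) \<and> c t \<in> ball x e \<inter> level_set \<and>
           metric (c t) (c' t) (c' t) \<le> (M * norm (z - y))\<^sup>2) \<and>
        continuous_on {0..1::real} c'"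
    by (rule local_arcs[OF x(2) e(1)], rule that)
  have curve: "z \<in> C \<and> (\<exists>\<gamma>\<in>curves_between metric C y z. curve_length metric \<gamma> \<le> M * dist y z)"
    if yz: "y \<in> ball x r \<inter> level_set" "z \<in> ball x r \<inter> level_set" and "y \<in> C" for y z
  proof -
    obtain c c' where cc': "c 0 = y \<and> c 1 = z \<and>
        (\<forall>t\<in>{0..1}. (c has_vector_derivative c' t) (at t) \<and> c t \<in> ball x e \<inter> level_set \<and>
           metric (c t) (c' t) (c' t) \<le> (M * norm (z - y))\<^sup>2) \<and>
        continuous_on {0..1::real} c'"
      using arc[OF yz] by (elim exE)
    then have c: "c 0 = y" "c 1 = z"
      "\<And>t. t \<in> {0..1} \<Longrightarrow> (c has_vector_derivative c' t) (at t)"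
      "\<And>t. t \<in> {0..1} \<Longrightarrow> c t \<in> ball x e \<inter> level_set"
      "\<And>t. t \<in> {0..1} \<Longrightarrow> metric (c t) (c' t) (c' t) \<le> (M * norm (z - y))\<^sup>2"
      "continuous_on {0..1} c'"
      by auto
    have cont: "continuous_on {0..1} c"
      using c(3) by (intro continuous_at_imp_continuous_on ballI has_vector_derivative_continuous) blast
    have "c ` {0..1} \<subseteq> C"
    proof (rule C_absorbs)
      show "connected (c ` {0..1})"
        by (intro connected_continuous_image cont) simp
      show "c ` {0..1} \<subseteq> H" using c(4) e(2) by blast
      show "y \<in> c ` {0..1}" using c(1) by force
    qed (rule \<open>y \<in> C\<close>)
    moreover have "continuous_on {0..1} (\<lambda>t. metric (c t) (c' t) (c' t))"
      unfolding metric_def by (intro continuous_intros cont c)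
    ultimately obtain \<gamma> where "\<gamma> \<in> curves_between metric C (c 0) (c 1)"
      "curve_length metric \<gamma> \<le> M * norm (z - y) * (1 - 0)"
      using C1_arc_curve[of 0 1 c c' C "M * norm (z - y)"] c(3,5,6) r(2) by auto
    moreover have "z \<in> C"
      using \<open>c ` {0..1} \<subseteq> C\<close> c(2) by force
    ultimately show ?thesis
      by (auto simp: c(1,2) dist_norm norm_minus_commute)
  qed
  have sub: "ball x r \<inter> level_set \<subseteq> C"
    using curve[of x] x assms r(1) by auto
  show thesis
    by (rule that[OF r sub conjunct2[OF curve]]) (use sub in blast)+
qed

lemma curves_exist:
  assumes "p \<in> C" "q \<in> C"
  shows "curves_between metric C p q \<noteq> {}"
proof (rule connected_equivalence_relation[of C p q "\<lambda>p q. curves_between metric C p q \<noteq> {}"])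
  show "connected C" using component by (rule in_components_connected)
  show "curves_between metric C y x \<noteq> {}" if "curves_between metric C x y \<noteq> {}" for x y
    using that curves_between_reverse(1) by blast
  show "curves_between metric C x z \<noteq> {}"
    if "curves_between metric C x y \<noteq> {}" "curves_between metric C y z \<noteq> {}" for x y z
    using that curves_between_join(1) by blast
  fix a assume a: "a \<in> C"
  then obtain r M where r: "r > 0" "ball a r \<inter> level_set \<subseteq> C"
    "\<And>y z. y \<in> ball a r \<inter> level_set \<Longrightarrow> z \<in> ball a r \<inter> level_set \<Longrightarrow>
      \<exists>\<gamma>\<in>curves_between metric C y z. curve_length metric \<gamma> \<le> M * dist y z"
    by (rule short_curves) blast
  have lev: "C \<subseteq> level_set" using C_subset H_subset_level_set by auto
  have "openin (top_of_set C) (C \<inter> ball a r)" by (simp add: openin_open_Int)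
  moreover have "\<forall>x\<in>C \<inter> ball a r. curves_between metric C a x \<noteq> {}"
  proof
    fix x assume x: "x \<in> C \<inter> ball a r"
    show "curves_between metric C a x \<noteq> {}"
      using r(3)[of a x] r(1) x a lev by auto
  qed
  ultimately show "\<exists>T. openin (top_of_set C) T \<and> a \<in> T \<and> (\<forall>x\<in>T. curves_between metric C a x \<noteq> {})"
    using a r(1) by (intro exI[of _ "C \<inter> ball a r"]) auto
qed (use assms in auto)

abbreviation rdist :: "'a \<Rightarrow> 'a \<Rightarrow> real"
  where "rdist \<equiv> riemannian_dist metric C"

lemma bdd_below_lengths: "bdd_below (curve_length metric ` curves_between metric C p q)"
  using curve_length_nonneg[OF _ C_subset] by (auto intro!: bdd_belowI[of _ 0])

lemma rdist_le:
  assumes "p \<in> C" "q \<in> C" "\<gamma> \<in> curves_between metric C p q"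
  shows "rdist p q \<le> curve_length metric \<gamma>"
  using assms by (auto simp: riemannian_dist_def intro: cINF_lower bdd_below_lengths)

lemma rdist_less:
  assumes "p \<in> C" "q \<in> C" "rdist p q < L"
  obtains \<gamma> where "\<gamma> \<in> curves_between metric C p q" "curve_length metric \<gamma> < L"
  using assms cINF_less_iff[OF curves_exist[OF assms(1,2)] bdd_below_lengths]
  by (auto simp: riemannian_dist_def)

lemma rdist_greatest:
  assumes "p \<in> C" "q \<in> C" "\<And>\<gamma>. \<gamma> \<in> curves_between metric C p q \<Longrightarrow> L \<le> curve_length metric \<gamma>"
  shows "L \<le> rdist p q"
  using assms curves_exist[of p q] by (auto simp: riemannian_dist_def intro!: cINF_greatest)

lemma rdist_lower_bound:
  assumes "x \<in> C"
  obtains k e where "k > 0" "e > 0" "\<And>y. y \<in> C \<Longrightarrow> k * min (dist x y) e \<le> rdist x y"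
proof -
  have "x \<in> H" using assms C_subset by auto
  then obtain k e where k: "k > 0" "e > 0" "\<And>z v. z \<in> cball x e \<Longrightarrow> k * (norm v)\<^sup>2 \<le> full_form z v"
    by (rule full_form_lower_bound) blast
  show thesis
  proof (rule that[of "sqrt k" e])
    fix y assume "y \<in> C"
    then show "sqrt k * min (dist x y) e \<le> rdist x y"
      using curve_length_lower_bound[OF _ C_subset k] by (intro rdist_greatest assms)
  qed (use k in auto)
qed

sublocale M: Metric_space C rdist
proof
  show nonneg: "0 \<le> rdist x y" for x y
  proof (cases "x \<in> C \<and> y \<in> C")
    case True
    then show ?thesis
      by (intro rdist_greatest curve_length_nonneg[OF _ C_subset]) auto
  qed (auto simp: riemannian_dist_def)
  have le: "rdist x y \<le> rdist y x" if "x \<in> C" "y \<in> C" for x y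
  proof (rule rdist_greatest[OF that(2,1)])
    fix \<gamma> assume "\<gamma> \<in> curves_between metric C y x"
    from rdist_le[OF that curves_between_reverse(1)[OF this]] curves_between_reverse(2)[OF this]
    show "rdist x y \<le> curve_length metric \<gamma>" by simp
  qed
  show "rdist x y = rdist y x" for x y
  proof (cases "x \<in> C \<and> y \<in> C")
    case True
    then show ?thesis
      using le[of x y] le[of y x] by auto
  qed (auto simp: riemannian_dist_def)
  show "rdist x y = 0 \<longleftrightarrow> x = y" if xy: "x \<in> C" "y \<in> C" for x y
  proof
    assume 0: "rdist x y = 0"
    obtain k e where "k > 0" "e > 0" "\<And>y. y \<in> C \<Longrightarrow> k * min (dist x y) e \<le> rdist x y"
      by (rule rdist_lower_bound[OF xy(1)]) blast
    then have "k * min (dist x y) e \<le> 0" using 0 xy(2) by metis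
    then have "min (dist x y) e \<le> 0" using \<open>k > 0\<close> by (simp add: mult_le_0_iff)
    then show "x = y" using \<open>e > 0\<close> by (auto simp: min_def split: if_splits)
  next
    assume "x = y"
    then show "rdist x y = 0"
      using rdist_le[OF xy] curves_between_const[OF xy(1)] nonneg[of x y] by force
  qed
  show "rdist x z \<le> rdist x y + rdist y z" if xyz: "x \<in> C" "y \<in> C" "z \<in> C" for x y z
  proof (rule field_le_epsilon)
    fix e :: real assume "e > 0"
    then obtain \<gamma>1 where \<gamma>1: "\<gamma>1 \<in> curves_between metric C x y" "curve_length metric \<gamma>1 < rdist x y + e/2"
      using rdist_less[OF xyz(1,2), of "rdist x y + e/2"] by auto
    from \<open>e > 0\<close> obtain \<gamma>2 where \<gamma>2: "\<gamma>2 \<in> curves_between metric C y z" "curve_length metric \<gamma>2 < rdist y z + e/2"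
      using rdist_less[OF xyz(2,3), of "rdist y z + e/2"] by auto
    have "rdist x z \<le> curve_length metric (\<gamma>1 +++ \<gamma>2)"
      using rdist_le[OF xyz(1,3) curves_between_join(1)[OF \<gamma>1(1) \<gamma>2(1)]] .
    also have "\<dots> = curve_length metric \<gamma>1 + curve_length metric \<gamma>2"
      using curves_between_join(2)[OF \<gamma>1(1) \<gamma>2(1)] .
    finally show "rdist x z \<le> rdist x y + rdist y z + e"
      using \<gamma>1(2) \<gamma>2(2) by simp
  qed
qed

lemma rdist_tendsto_0:
  assumes "x \<in> C" "\<And>n. \<sigma> n \<in> C" "\<sigma> \<longlonglongrightarrow> x"
  shows "(\<lambda>n. rdist (\<sigma> n) x) \<longlonglongrightarrow> 0"
proof -
  obtain r M where r: "r > 0" "M \<ge> 0"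
    "\<And>y z. y \<in> ball x r \<inter> level_set \<Longrightarrow> z \<in> ball x r \<inter> level_set \<Longrightarrow>
      \<exists>\<gamma>\<in>curves_between metric C y z. curve_length metric \<gamma> \<le> M * dist y z"
    by (rule short_curves[OF assms(1)]) blast
  have lev: "C \<subseteq> level_set" using C_subset H_subset_level_set by auto
  have "\<forall>\<^sub>F n in sequentially. rdist (\<sigma> n) x \<le> M * dist (\<sigma> n) x"
    using tendstoD[OF assms(3) r(1)]
  proof eventually_elim
    case (elim n)
    then have "\<sigma> n \<in> ball x r \<inter> level_set" "x \<in> ball x r \<inter> level_set"
      using assms(1,2) lev r(1) by (auto simp: dist_commute)
    from r(3)[OF this] rdist_le[OF assms(2,1)] show ?case by force
  qed
  moreover have "(\<lambda>n. M * dist (\<sigma> n) x) \<longlonglongrightarrow> M * 0"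
    by (intro tendsto_intros tendsto_dist_iff[THEN iffD1] assms)
  ultimately show ?thesis
    by (intro tendsto_sandwich[of "\<lambda>_. 0" "\<lambda>n. rdist (\<sigma> n) x"]) auto
qed

lemma rdist_limit_imp_tendsto:
  assumes "limitin M.mtopology \<sigma> x sequentially"
  shows "\<sigma> \<longlonglongrightarrow> x"
proof (rule tendstoI)
  have x: "x \<in> C" and ev: "\<And>\<epsilon>. \<epsilon> > 0 \<Longrightarrow> \<forall>\<^sub>F n in sequentially. \<sigma> n \<in> C \<and> rdist (\<sigma> n) x < \<epsilon>"
    using assms by (auto simp: M.limitin_metric)
  obtain k e where k: "k > 0" "e > 0" "\<And>y. y \<in> C \<Longrightarrow> k * min (dist x y) e \<le> rdist x y"
    by (rule rdist_lower_bound[OF x]) blast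
  fix \<epsilon> :: real assume "\<epsilon> > 0"
  then have "k * min \<epsilon> e > 0" using k by simp
  from ev[OF this] show "\<forall>\<^sub>F n in sequentially. dist (\<sigma> n) x < \<epsilon>"
  proof eventually_elim
    case (elim n)
    then have "k * min (dist x (\<sigma> n)) e < k * min \<epsilon> e"
      using k(3)[of "\<sigma> n"] M.commute[of x "\<sigma> n"] by simp
    then have "min (dist x (\<sigma> n)) e < min \<epsilon> e" using k(1) by simp
    then show ?case by (auto simp: min_def dist_commute split: if_splits)
  qed
qed

end

section \<open>Complete implies closed\<close>

context special_real_hypersurface
begin

text \<open>Let \<open>p\<close> be a limit point of \<open>H\<close> outside \<open>H\<close>. It lies on the level set, so an arc
  with bounded speed runs inside the level set from a point of \<open>H\<close> to \<open>p\<close>. The part of the arc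
  before its first exit from \<open>H\<close> has finite length and hence gives a Cauchy sequence without limit in
  \<open>H\<close>.\<close>

lemma complete_imp_closed:
  assumes complete: "riemannian_complete H metric"
  shows "closed H"
proof (rule ccontr)
  assume "\<not> closed H"
  then obtain p where p: "p \<in> closure H" "p \<notin> H"
    using closure_subset_eq by blast
  have "closed level_set"
    unfolding level_set_def by (intro closed_Collect_eq continuous_intros)
  with p(1) have pl: "p \<in> level_set"
    using closure_minimal[OF H_subset_level_set] by auto
  obtain r M where r: "r > 0" "M \<ge> 0" and
    arc: "\<And>y z. y \<in> ball p r \<inter> level_set \<Longrightarrow> z \<in> ball p r \<inter> level_set \<Longrightarrow>
      \<exists>c c'. c 0 = y \<and> c 1 = z \<and>
        (\<forall>t\<in>{0..1}. (c has_vector_derivative c' t) (at t) \<and> c t \<in> ball p 1 \<inter> level_set \<and>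
           metric (c t) (c' t) (c' t) \<le> (M * norm (z - y))\<^sup>2) \<and>
        continuous_on {0..1::real} c'"
    by (rule local_arcs[OF pl zero_less_one], rule that)
  obtain q where q: "q \<in> H" "dist q p < r"
    using p(1) r(1) unfolding closure_approachable by blast
  then have qp: "q \<in> ball p r \<inter> level_set" "p \<in> ball p r \<inter> level_set"
    using r(1) pl H_subset_level_set by (auto simp: dist_commute)
  define L where "L = M * norm (p - q)"
  obtain c c' where cc': "c 0 = q \<and> c 1 = p \<and>
        (\<forall>t\<in>{0..1}. (c has_vector_derivative c' t) (at t) \<and> c t \<in> ball p 1 \<inter> level_set \<and>
           metric (c t) (c' t) (c' t) \<le> L\<^sup>2) \<and>
        continuous_on {0..1::real} c'"
    using arc[OF qp] unfolding L_def by (elim exE)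
  then have c: "c 0 = q" "c 1 = p"
      "\<And>t. t \<in> {0..1} \<Longrightarrow> (c has_vector_derivative c' t) (at t)"
      "\<And>t. t \<in> {0..1} \<Longrightarrow> c t \<in> level_set"
      "\<And>t. t \<in> {0..1} \<Longrightarrow> metric (c t) (c' t) (c' t) \<le> L\<^sup>2"
      "continuous_on {0..1} c'"
    by auto
  have cont: "continuous_on {0..1} c"
    using c(3) by (intro continuous_at_imp_continuous_on ballI has_vector_derivative_continuous) blast
  \<comment> \<open>\<open>B\<close> consists of the parameters outside \<open>H\<close>, and is closed because \<open>H\<close> is open in
    the level set; its least element \<open>s\<close> is the first exit.\<close>
  obtain U where U: "open U" "H = level_set \<inter> U"
    using open_in_level_set by (auto simp: openin_open)
  define B where "B = {0..1} \<inter> c -` (- U)"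
  have B: "t \<in> B \<longleftrightarrow> t \<in> {0..1} \<and> c t \<notin> H" for t
    using c(4)[of t] U(2) by (auto simp: B_def)
  have "closed B"
    unfolding B_def using U(1) by (intro continuous_closed_preimage cont) auto
  moreover have "bounded B"
    by (rule bounded_subset[of "{0..1}"]) (auto simp: B_def)
  ultimately have "compact B" by (simp add: compact_eq_bounded_closed)
  moreover have "1 \<in> B" using p(2) c(2) by (simp add: B)
  ultimately obtain s where s: "s \<in> B" "\<And>t. t \<in> B \<Longrightarrow> s \<le> t"
    using compact_attains_inf[of B] by blast
  have s01: "s \<in> {0..1}" "c s \<notin> H" using s(1) by (auto simp: B)
  have "s \<noteq> 0" using s01(2) q(1) c(1) by auto
  with s01 have "s > 0" by auto
  have inH: "c t \<in> H" if "t \<in> {0..<s}" for t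
    using s(2)[of t] s01 that B[of t] by auto
  define C where "C = connected_component_set H q"
  have C: "C \<in> components H"
    using q(1) by (auto simp: C_def components_def)
  interpret special_real_component T H C
    by standard (rule C)
  have inC: "c ` {0..<s} \<subseteq> C"
  proof (rule C_absorbs)
    show "connected (c ` {0..<s})"
      using s01 by (intro connected_continuous_image continuous_on_subset[OF cont]) auto
    show "c ` {0..<s} \<subseteq> H" using inH by auto
    show "q \<in> c ` {0..<s}" using c(1) \<open>s > 0\<close> by force
    show "q \<in> C" using q(1) by (simp add: C_def)
  qed
  have "0 \<le> L" using r(2) by (simp add: L_def)
  have mono: "rdist (c a) (c b) \<le> L * (b - a)" if ab: "a \<in> {0..<s}" "b \<in> {0..<s}" "a < b" for a b
  proof -
    have sub: "{a..b} \<subseteq> {0..1}" using ab s01 by auto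
    have "c ` {a..b} \<subseteq> C" using inC ab by auto
    moreover have "continuous_on {a..b} (\<lambda>t. metric (c t) (c' t) (c' t))"
      unfolding metric_def
      by (intro continuous_intros continuous_on_subset[OF cont sub] continuous_on_subset[OF c(6) sub])
    ultimately obtain \<gamma> where "\<gamma> \<in> curves_between metric C (c a) (c b)"
      "curve_length metric \<gamma> \<le> L * (b - a)"
      using C1_arc_curve[of a b c c' C L] ab(3) c(3,5) sub \<open>0 \<le> L\<close> continuous_on_subset[OF c(6) sub]
      by (metis (no_types, lifting) subsetD)
    moreover have "c a \<in> C" "c b \<in> C" using inC ab by auto
    ultimately show ?thesis using rdist_le by force
  qed
  have lip: "rdist (c a) (c b) \<le> L * \<bar>a - b\<bar>" if ab: "a \<in> {0..<s}" "b \<in> {0..<s}" for a b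
  proof -
    have "c a \<in> C" using inC ab by auto
    then show ?thesis
      using mono[OF ab] mono[OF ab(2,1)] M.commute[of "c a" "c b"] by (cases a b rule: linorder_cases) auto
  qed
  define \<tau> where "\<tau> n = s * (1 - inverse (real (Suc n)))" for n
  have \<tau>_in: "\<tau> n \<in> {0..<s}" for n
  proof -
    have "0 < inverse (real (Suc n))" "inverse (real (Suc n)) \<le> 1"
      by (auto simp: field_simps)
    then show ?thesis using \<open>s > 0\<close> by (auto simp: \<tau>_def)
  qed
  have "\<tau> \<longlonglongrightarrow> s * (1 - 0)"
    unfolding \<tau>_def by (intro tendsto_intros LIMSEQ_inverse_real_of_nat)
  then have \<tau>_lim: "\<tau> \<longlonglongrightarrow> s" by simp
  then have "Cauchy \<tau>" by (rule LIMSEQ_imp_Cauchy)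
  have "M.MCauchy (c \<circ> \<tau>)"
    unfolding M.MCauchy_def
  proof (intro conjI allI impI)
    show "range (c \<circ> \<tau>) \<subseteq> C" using inC \<tau>_in by auto
    fix \<epsilon> :: real assume "\<epsilon> > 0"
    \<comment> \<open>\<open>L + 1\<close> instead of \<open>L\<close>, which may be 0\<close>
    then have "\<epsilon> / (L + 1) > 0" using \<open>0 \<le> L\<close> by simp
    with \<open>Cauchy \<tau>\<close> obtain N where N: "\<And>m n. m \<ge> N \<Longrightarrow> n \<ge> N \<Longrightarrow> dist (\<tau> m) (\<tau> n) < \<epsilon> / (L + 1)"
      unfolding Cauchy_def by blast
    show "\<exists>N. \<forall>n n'. N \<le> n \<longrightarrow> N \<le> n' \<longrightarrow> rdist ((c \<circ> \<tau>) n) ((c \<circ> \<tau>) n') < \<epsilon>"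
    proof (intro exI[of _ N] allI impI)
      fix n n' assume n: "N \<le> n" "N \<le> n'"
      have "rdist ((c \<circ> \<tau>) n) ((c \<circ> \<tau>) n') \<le> L * \<bar>\<tau> n - \<tau> n'\<bar>"
        using lip[OF \<tau>_in \<tau>_in] by simp
      also have "\<dots> \<le> (L + 1) * \<bar>\<tau> n - \<tau> n'\<bar>"
        by (intro mult_right_mono) auto
      also have "\<dots> < \<epsilon>"
        using N[OF n] \<open>0 \<le> L\<close> by (simp add: dist_real_def field_simps)
      finally show "rdist ((c \<circ> \<tau>) n) ((c \<circ> \<tau>) n') < \<epsilon>" .
    qed
  qed
  moreover have "M.mcomplete"
    using complete C by (simp add: riemannian_complete_def)
  ultimately obtain x where x: "limitin M.mtopology (c \<circ> \<tau>) x sequentially"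
    unfolding M.mcomplete_def by blast
  then have "x \<in> C" by (simp add: M.limitin_metric)
  have "(\<lambda>n. c (\<tau> n)) \<longlonglongrightarrow> c s"
  proof (rule continuous_on_tendsto_compose[OF cont \<tau>_lim s01(1)])
    have "\<tau> n \<in> {0..1}" for n using \<tau>_in[of n] s01(1) by auto
    then show "\<forall>\<^sub>F n in sequentially. \<tau> n \<in> {0..1}" by simp
  qed
  moreover have "(\<lambda>n. c (\<tau> n)) \<longlonglongrightarrow> x"
    using rdist_limit_imp_tendsto[OF x] by (simp add: o_def)
  ultimately have "c s = x" by (rule LIMSEQ_unique)
  with \<open>x \<in> C\<close> C_subset s01(2) show False by auto
qed

end

section \<open>Closed implies complete\<close>

context special_real_hypersurface
begin

text \<open>A closed \<open>H\<close> is a union of connected components of the level set.\<close>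

lemma clopen_absorbs:
  assumes "closed H" "connected K" "K \<subseteq> level_set" "x \<in> K" "x \<in> H"
  shows "K \<subseteq> H"
proof -
  have "openin (top_of_set K) (K \<inter> H)"
    using open_in_level_set assms(3) by (auto simp: openin_open)
  moreover have "closedin (top_of_set K) (K \<inter> H)"
    using assms(1) by (simp add: closedin_closed_Int)
  ultimately have "K \<inter> H = {} \<or> K \<inter> H = K"
    using assms(2) unfolding connected_clopen by blast
  then show ?thesis using assms(4,5) by auto
qed

text \<open>Restricted to the line through \<open>p\<close> in
  direction \<open>w\<close>, the cubic is \<open>1 + 3 * T p w w * t\<^sup>2 + b * t ^ 3\<close> with \<open>b > 0\<close> and a local minimum at
  \<open>s > 0\<close>. If the asserted inequality failed, then the value at this minimum would be positive. So
  the segment from \<open>p\<close> to \<open>p + s *\<^sub>R w\<close> could be projected centrally to the level set, and the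
  projected curve would stay in \<open>H\<close>, which is open and closed in the level set. At its endpoint,
  however, \<open>w\<close> is tangent, since \<open>s\<close> is a critical point, while the second derivative in direction
  \<open>w\<close> is positive, against the negativity of the Hessian. In other words, the restricted cubic has
  only real roots, and the inequality says that its discriminant is nonnegative.\<close>

lemma cubic_bound_positive:
  assumes "closed H" and p: "p \<in> H" "T p p w = 0" and b: "T w w w > 0"
  shows "2 * (T w w w)\<^sup>2 \<le> (metric p w w) ^ 3"
proof (rule ccontr)
  assume *: "\<not> 2 * (T w w w)\<^sup>2 \<le> (metric p w w) ^ 3"
  define b where "b = T w w w"
  have "w \<noteq> 0" using b by auto
  then have neg: "T p w w < 0" using negative_on_tangent p by blast
  \<comment> \<open>the positive critical point of \<open>t \<mapsto> T (p + t *\<^sub>R w) (p + t *\<^sub>R w) (p + t *\<^sub>R w)\<close>\<close>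
  define s where "s = - 2 * T p w w / b"
  have "b > 0" using b by (simp add: b_def)
  with neg have "s > 0" by (auto simp: s_def field_simps)
  have Tpww: "T p w w = - b * s / 2"
    using \<open>b > 0\<close> by (simp add: s_def)
  have "(metric p w w) ^ 3 = b\<^sup>2 * (b * s ^ 3)"
    by (simp add: metric_def Tpww power2_eq_square power3_eq_cube)
  with * have "b\<^sup>2 * (b * s ^ 3) < b\<^sup>2 * 2" by (simp add: b_def)
  then have bs: "b * s ^ 3 < 2" using \<open>b > 0\<close> by simp
  have perm: "T p w p = 0" "T w p p = 0" "T w p w = T p w w" "T w w p = T p w w"
    using p(2) swap23[of p w p] swap_last_to_first[of w p p] swap12[of w p w]
      swap_last_to_first[of p w w] by auto
  \<comment> \<open>expansion of the cubic around its critical point \<open>s\<close>, exhibiting \<open>1 - b * s ^ 3 / 2\<close> as the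
    minimum for nonnegative \<open>t\<close>\<close>
  have expand: "T (p + t *\<^sub>R w) (p + t *\<^sub>R w) (p + t *\<^sub>R w)
      = (1 - b * s ^ 3 / 2) + b * ((t - s)\<^sup>2 * (t + s / 2))" for t
    by (simp add: trilinear_simps H_level[OF p(1)] p(2) perm Tpww flip: b_def)
      (simp add: field_simps power2_eq_square power3_eq_cube)
  have pos: "T (p + t *\<^sub>R w) (p + t *\<^sub>R w) (p + t *\<^sub>R w) > 0" if "t \<in> {0..s}" for t
  proof -
    have "0 \<le> b * ((t - s)\<^sup>2 * (t + s / 2))"
      using \<open>b > 0\<close> \<open>s > 0\<close> that by (intro mult_nonneg_nonneg) auto
    then show ?thesis unfolding expand using bs by linarith
  qed
  define c where "c t = central_projection (p + t *\<^sub>R w)" for t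
  have "c ` {0..s} \<subseteq> H"
  proof (rule clopen_absorbs[OF assms(1)])
    show "connected (c ` {0..s})"
      unfolding c_def using pos
      by (intro connected_continuous_image continuous_on_central_projection continuous_intros) auto
    show "c ` {0..s} \<subseteq> level_set"
      using pos by (auto simp: c_def intro: central_projection_in_level_set)
    show "p \<in> c ` {0..s}"
      using \<open>s > 0\<close> p(1) H_subset_level_set
      by (intro image_eqI[of _ _ 0]) (auto simp: c_def central_projection_id)
  qed (rule p(1))
  then have cH: "c s \<in> H" using \<open>s > 0\<close> by auto
  define l where "l = (T (p + s *\<^sub>R w) (p + s *\<^sub>R w) (p + s *\<^sub>R w)) powr (-1/3)"
  have cs: "c s = l *\<^sub>R (p + s *\<^sub>R w)"
    by (simp add: c_def central_projection_def l_def)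
  have "l > 0"
    unfolding l_def using pos[of s] \<open>s > 0\<close> by auto
  have "T (c s) (c s) w = 0"
    by (simp add: cs trilinear_simps p(2) perm Tpww flip: b_def)
  moreover have "0 < l * (b * s / 2)"
    using \<open>l > 0\<close> \<open>b > 0\<close> \<open>s > 0\<close> by simp
  moreover have "T (c s) w w = l * (b * s / 2)"
    by (simp add: cs trilinear_simps Tpww algebra_simps flip: b_def)
  ultimately show False
    using negative_on_tangent[OF cH _ \<open>w \<noteq> 0\<close>] by linarith
qed

lemma cubic_bound:
  assumes "closed H" "p \<in> H" "T p p w = 0"
  shows "2 * (T w w w)\<^sup>2 \<le> (metric p w w) ^ 3"
proof -
  consider "T w w w > 0" | "T (- w) (- w) (- w) > 0" | "T w w w = 0"
    by (fastforce simp: minus)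
  then show ?thesis
  proof cases
    case 1
    then show ?thesis by (rule cubic_bound_positive[OF assms])
  next
    case 2
    have "T p p (- w) = 0" using assms(3) by (simp add: minus)
    from cubic_bound_positive[OF assms(1,2) this 2] show ?thesis
      by (simp add: metric_def minus)
  next
    case 3
    then show ?thesis using metric_nonneg[OF assms(2,3)] by simp
  qed
qed

text \<open>The Cauchy--Schwarz and parallelogram bounds for unit vectors, both from
  nonnegativity of the metric on \<open>w + u\<close> and \<open>w - u\<close>.\<close>

lemma metric_unit_bound:
  assumes p: "p \<in> H" and u: "T p p u = 0" "metric p u u = 1" and w: "T p p w = 0" "metric p w w = 1"
  shows "\<bar>metric p u w\<bar> \<le> 1" "metric p (w + u) (w + u) \<le> 4" "metric p (w - u) (w - u) \<le> 4"
proof -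
  have "0 \<le> metric p (w + u) (w + u)" "0 \<le> metric p (w - u) (w - u)"
    using u w by (auto intro!: metric_nonneg p simp: trilinear_simps)
  then show "\<bar>metric p u w\<bar> \<le> 1" "metric p (w + u) (w + u) \<le> 4" "metric p (w - u) (w - u) \<le> 4"
    using u(2) w(2) swap23[of p w u] by (auto simp: metric_def trilinear_simps)
qed

text \<open>Polarisation: \<open>6 * T u w w\<close> is a combination of the cubes of \<open>w + u\<close>, \<open>w - u\<close> and \<open>u\<close>, whose
  squared lengths are at most 4, 4 and 1.\<close>

lemma trilinear_unit_bound:
  assumes "closed H" and p: "p \<in> H" and u: "T p p u = 0" "metric p u u = 1"
    and w: "T p p w = 0" "metric p w w = 1"
  shows "\<bar>T u w w\<bar> \<le> 3"
proof -
  have abs_le: "\<bar>T v v v\<bar> \<le> 6" if "T p p v = 0" "metric p v v \<le> 4" for v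
  proof -
    have "2 * (T v v v)\<^sup>2 \<le> (metric p v v) ^ 3"
      using cubic_bound[OF assms(1) p that(1)] .
    also have "\<dots> \<le> 4 ^ 3"
      using metric_nonneg[OF p that(1)] that(2) by (intro power_mono) auto
    finally have "(T v v v)\<^sup>2 \<le> 6\<^sup>2" by simp
    then have "\<bar>T v v v\<bar> \<le> \<bar>6\<bar>" by (simp only: abs_le_square_iff)
    then show ?thesis by simp
  qed
  have "2 * (T u u u)\<^sup>2 \<le> 1"
    using cubic_bound[OF assms(1) p u(1)] u(2) by simp
  then have "(T u u u)\<^sup>2 \<le> 1\<^sup>2" by simp
  then have "\<bar>T u u u\<bar> \<le> \<bar>1\<bar>" by (simp only: abs_le_square_iff)
  then have "\<bar>T u u u\<bar> \<le> 1" by simp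
  moreover have "\<bar>T (w + u) (w + u) (w + u)\<bar> \<le> 6"
    using metric_unit_bound[OF p u w] u(1) w(1) by (intro abs_le) (simp_all add: trilinear_simps)
  moreover have "\<bar>T (w - u) (w - u) (w - u)\<bar> \<le> 6"
    using metric_unit_bound[OF p u w] u(1) w(1) by (intro abs_le) (simp_all add: trilinear_simps)
  moreover have "6 * T u w w
      = T (w + u) (w + u) (w + u) - T (w - u) (w - u) (w - u) - 2 * T u u u"
    using swap12[of w u w] swap_last_to_first[of u w w] swap23[of u w u] swap_last_to_first[of w u u]
    by (simp add: trilinear_simps)
  ultimately show ?thesis by linarith
qed

text \<open>Normalisation in a form that also covers the zero vector.\<close>

lemma tangent_unit_vector:
  assumes p: "p \<in> H" "T p p u = 0"
  obtains v where "T p p v = 0" "u = sqrt (metric p u u) *\<^sub>R v" "u \<noteq> 0 \<Longrightarrow> metric p v v = 1"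
proof (cases "u = 0")
  case True
  then show ?thesis by (intro that[of 0]) (auto simp: metric_def)
next
  case False
  define s where "s = sqrt (metric p u u)"
  have "metric p u u > 0"
    using negative_on_tangent[OF p False] by (simp add: metric_def)
  then have s: "s > 0" "s\<^sup>2 = metric p u u" by (auto simp: s_def)
  show ?thesis
  proof (rule that[of "inverse s *\<^sub>R u"])
    show "T p p (inverse s *\<^sub>R u) = 0" using p by (simp add: trilinear_simps)
    show "u = sqrt (metric p u u) *\<^sub>R (inverse s *\<^sub>R u)"
      using s unfolding s_def[symmetric] by simp
    show "metric p (inverse s *\<^sub>R u) (inverse s *\<^sub>R u) = 1"
      unfolding metric_quadratic s(2)[symmetric] using s(1) by (simp add: power_inverse)
  qed
qed

text \<open>The left-hand side is the derivative of \<open>full_form p v\<close>, for fixed \<open>v\<close>, when \<open>p\<close> moves with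
  velocity \<open>u\<close>. Splitting \<open>v = a *\<^sub>R p + w\<close> with \<open>w\<close> tangent turns it into
  \<open>8 * a * T p u w - 2 * T u w w\<close>. This is the self-concordance of minus the logarithm of
  the cubic, familiar from interior point methods.\<close>

lemma full_form_derivative_bound:
  assumes "closed H" and p: "p \<in> H" and u: "T p p u = 0"
  shows "\<bar>- 2 * T u v v + 12 * T p p v * T p u v\<bar> \<le> 8 * sqrt (metric p u u) * full_form p v"
proof -
  define a where "a = T p p v"
  define w where "w = v - a *\<^sub>R p"
  have w: "T p p w = 0" unfolding w_def a_def by (rule tangential_part[OF p])
  obtain u1 where u1: "T p p u1 = 0" "u = sqrt (metric p u u) *\<^sub>R u1" "u \<noteq> 0 \<Longrightarrow> metric p u1 u1 = 1"
    by (rule tangent_unit_vector[OF p u], rule that)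
  obtain w1 where w1: "T p p w1 = 0" "w = sqrt (metric p w w) *\<^sub>R w1" "w \<noteq> 0 \<Longrightarrow> metric p w1 w1 = 1"
    by (rule tangent_unit_vector[OF p w], rule that)
  define s where "s = sqrt (metric p u u)"
  define t where "t = sqrt (metric p w w)"
  have s: "0 \<le> s" "u = s *\<^sub>R u1" and t: "0 \<le> t" "w = t *\<^sub>R w1" "t\<^sup>2 = metric p w w"
    using metric_nonneg[OF p u] metric_nonneg[OF p w] u1(2) w1(2) by (auto simp: s_def t_def)
  have bounds: "2 * \<bar>T p u w\<bar> \<le> s * t \<and> \<bar>T u w w\<bar> \<le> 3 * s * t\<^sup>2"
  proof (cases "u = 0 \<or> w = 0")
    case True
    then show ?thesis using s(1) t(1) by auto
  next
    case False
    have "2 * \<bar>T p u1 w1\<bar> \<le> 1"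
      using metric_unit_bound(1)[OF p u1(1) _ w1(1)] u1(3) w1(3) False by (simp add: metric_def abs_mult)
    moreover have "\<bar>T u1 w1 w1\<bar> \<le> 3"
      using trilinear_unit_bound[OF assms(1) p u1(1) _ w1(1)] u1(3) w1(3) False by simp
    ultimately have "s * t * (2 * \<bar>T p u1 w1\<bar>) \<le> s * t * 1" "s * t\<^sup>2 * \<bar>T u1 w1 w1\<bar> \<le> s * t\<^sup>2 * 3"
      using s(1) t(1) by (intro mult_left_mono mult_nonneg_nonneg; simp)+
    moreover have "\<bar>T p u w\<bar> = s * t * \<bar>T p u1 w1\<bar>" "\<bar>T u w w\<bar> = s * t\<^sup>2 * \<bar>T u1 w1 w1\<bar>"
      using s(1) t(1) by (simp_all add: s(2) t(2) trilinear_simps abs_mult power2_eq_square)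
    ultimately show ?thesis by (simp add: mult_ac)
  qed
  have v: "v = a *\<^sub>R p + w" by (simp add: w_def)
  have "T p u p = 0" "T u p p = 0" "T u p w = T p u w" "T u w p = T p u w" "T p p p = 1"
    using u swap23[of p u p] swap12[of u p p] swap12[of u p w] swap23[of u w p] H_level[OF p] by auto
  then have "- 2 * T u v v + 12 * T p p v * T p u v = 8 * a * T p u w - 2 * T u w w"
    unfolding a_def[symmetric] by (subst (1 2 3) v) (simp add: trilinear_simps algebra_simps)
  also have "\<bar>\<dots>\<bar> \<le> 8 * \<bar>a\<bar> * \<bar>T p u w\<bar> + 2 * \<bar>T u w w\<bar>"
    by (rule order_trans[OF abs_triangle_ineq4]) (simp add: abs_mult)
  also have "\<dots> \<le> 4 * \<bar>a\<bar> * (s * t) + 2 * (3 * s * t\<^sup>2)"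
  proof -
    have "8 * \<bar>a\<bar> * \<bar>T p u w\<bar> = 4 * \<bar>a\<bar> * (2 * \<bar>T p u w\<bar>)" by simp
    also have "\<dots> \<le> 4 * \<bar>a\<bar> * (s * t)"
      using bounds by (intro mult_left_mono) auto
    finally show ?thesis using bounds by linarith
  qed
  also have "\<dots> \<le> 8 * s * (a\<^sup>2 + t\<^sup>2)"
  proof -
    have "0 \<le> s * (2 * (\<bar>a\<bar> - t)\<^sup>2 + 6 * \<bar>a\<bar>\<^sup>2)"
      using s(1) by (intro mult_nonneg_nonneg) auto
    also have "\<dots> = 8 * s * (\<bar>a\<bar>\<^sup>2 + t\<^sup>2) - (4 * \<bar>a\<bar> * (s * t) + 2 * (3 * s * t\<^sup>2))"
      by (simp add: algebra_simps power2_eq_square)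
    finally show ?thesis by simp
  qed
  also have "a\<^sup>2 + t\<^sup>2 = full_form p v"
    unfolding full_form_split[OF p] t(3) by (simp add: a_def w_def)
  finally show ?thesis by (simp add: s_def)
qed

text \<open>Integrated form of the previous bound: along a curve, the logarithmic derivative of
  \<open>full_form (\<gamma> t) v\<close> is at most 8 times the speed.\<close>

lemma full_form_growth:
  assumes "closed H" and \<gamma>: "\<gamma> \<in> curves_between metric C x y" and C: "C \<subseteq> H" and "v \<noteq> 0"
  shows "full_form x v \<le> exp (8 * curve_length metric \<gamma>) * full_form y v"
proof -
  have \<gamma>': "valid_path \<gamma>" "path_image \<gamma> \<subseteq> H" "\<gamma> 0 = x" "\<gamma> 1 = y" "speed metric \<gamma> integrable_on {0..1}"
    using \<gamma> C by (auto simp: curves_between_def pathstart_def pathfinish_def)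
  have cont: "continuous_on {0..1} \<gamma>"
    using valid_path_imp_path[OF \<gamma>'(1)] by (simp add: path_def)
  have H: "\<gamma> t \<in> H" if "t \<in> {0..1}" for t
    using \<gamma>'(2) that by (auto simp: path_image_def)
  have pos: "full_form (\<gamma> t) v > 0" if "t \<in> {0..1}" for t
    using full_form_pos[OF H[OF that] \<open>v \<noteq> 0\<close>] .
  obtain S w where S: "finite S"
    "\<And>t. t \<in> {0..1} - S \<Longrightarrow> (\<gamma> has_vector_derivative w t) (at t)"
    "\<And>t. t \<in> {0..1} - S \<Longrightarrow> T (\<gamma> t) (\<gamma> t) (w t) = 0"
    "\<And>t. t \<in> {0..1} - S \<Longrightarrow> speed metric \<gamma> t = sqrt (metric (\<gamma> t) (w t) (w t))"
    by (rule velocity_tangent[OF \<gamma> C], rule that)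
  define D where "D t = - 2 * T (w t) v v + 12 * T (\<gamma> t) (\<gamma> t) v * T (\<gamma> t) (w t) v" for t
  have "norm (ln (full_form (\<gamma> 1) v) - ln (full_form (\<gamma> 0) v)) \<le> 8 * curve_length metric \<gamma>"
  proof (rule variation_le_curve_length[OF \<gamma>'(5), where u' = "\<lambda>t. D t / full_form (\<gamma> t) v"])
    show "continuous_on {0..1} (\<lambda>t. ln (full_form (\<gamma> t) v))"
      using pos by (intro continuous_intros continuous_on_full_form cont) force
    show "0 \<le> speed metric \<gamma> t" if "t \<in> {0..1} - S" for t
      using S(3,4)[OF that] metric_nonneg[OF H, of t] that by simp
    fix t assume t: "t \<in> {0..1} - S"
    then have t01: "t \<in> {0..1}" by simp
    note v = S(2)[OF t] has_vector_derivative_const[of v]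
    have "((\<lambda>t. - 2 * T (\<gamma> t) v v + 3 * (T (\<gamma> t) (\<gamma> t) v)\<^sup>2) has_real_derivative D t) (at t)"
      using swap12[of "w t" "\<gamma> t" v]
      by (auto intro!: derivative_eq_intros has_vector_derivative_T v simp: D_def)
    from DERIV_ln_divide[THEN DERIV_chain2, OF _ this] pos[OF t01]
    show "((\<lambda>t. ln (full_form (\<gamma> t) v)) has_vector_derivative D t / full_form (\<gamma> t) v) (at t)"
      by (simp add: full_form_def flip: has_real_derivative_iff_has_vector_derivative)
    have "\<bar>D t\<bar> \<le> 8 * speed metric \<gamma> t * full_form (\<gamma> t) v"
      unfolding D_def S(4)[OF t] by (rule full_form_derivative_bound[OF assms(1) H[OF t01] S(3)[OF t]])
    then show "norm (D t / full_form (\<gamma> t) v) \<le> 8 * speed metric \<gamma> t"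
      using pos[OF t01] by (simp add: abs_divide divide_le_eq)
  qed (use S in auto)
  then have "ln (full_form x v) \<le> 8 * curve_length metric \<gamma> + ln (full_form y v)"
    using \<gamma>'(3,4) by (simp add: abs_le_iff)
  then have "exp (ln (full_form x v)) \<le> exp (8 * curve_length metric \<gamma> + ln (full_form y v))"
    by simp
  then show ?thesis
    using pos[of 0] pos[of 1] \<gamma>'(3,4) by (simp add: exp_add)
qed

text \<open>At a point \<open>y\<close> of \<open>H\<close> the form takes the value 1 on \<open>y\<close> itself. By \<open>full_form_growth\<close>,
  the fixed positive definite form at \<open>x\<close> is therefore bounded on all \<open>y\<close> within a bounded
  distance of \<open>x\<close>. So Cauchy sequences are Euclidean bounded, and closedness of \<open>H\<close> provides
  a convergent subsequence.\<close>

lemma closed_imp_complete: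
  assumes "closed H"
  shows "riemannian_complete H metric"
  unfolding riemannian_complete_def
proof
  fix C assume C: "C \<in> components H"
  interpret special_real_component T H C
    by standard (rule C)
  show "M.mcomplete"
    unfolding M.mcomplete_def
  proof (intro allI impI)
    fix \<sigma> assume \<sigma>: "M.MCauchy \<sigma>"
    have \<sigma>C: "\<sigma> n \<in> C" for n using \<sigma> by (auto simp: M.MCauchy_def)
    obtain N where N: "\<And>n n'. N \<le> n \<Longrightarrow> N \<le> n' \<Longrightarrow> rdist (\<sigma> n) (\<sigma> n') < 1"
      using \<sigma> unfolding M.MCauchy_def by (metis zero_less_one)
    define x where "x = \<sigma> N"
    have x: "x \<in> C" "x \<in> H" using \<sigma>C C_subset by (auto simp: x_def)
    obtain k e where k: "k > 0" "e > 0" "\<And>z v. z \<in> cball x e \<Longrightarrow> k * (norm v)\<^sup>2 \<le> full_form z v"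
      by (rule full_form_lower_bound[OF x(2)], rule that)
    \<comment> \<open>the tail of \<open>\<sigma>\<close> has distance less than 1 from \<open>x\<close>, whence the exponent \<open>8 * 1\<close>\<close>
    have bound: "k * (norm (\<sigma> n))\<^sup>2 \<le> exp 8" if n: "n \<ge> N" for n
    proof -
      obtain \<gamma> where \<gamma>: "\<gamma> \<in> curves_between metric C x (\<sigma> n)" "curve_length metric \<gamma> < 1"
        using rdist_less[OF x(1) \<sigma>C] N[OF order_refl n] by (auto simp: x_def)
      have y: "T (\<sigma> n) (\<sigma> n) (\<sigma> n) = 1" using \<sigma>C C_subset H_level by blast
      then have "full_form (\<sigma> n) (\<sigma> n) = 1" "\<sigma> n \<noteq> 0"
        by (auto simp: full_form_def)
      then have "full_form x (\<sigma> n) \<le> exp (8 * curve_length metric \<gamma>)"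
        using full_form_growth[OF assms \<gamma>(1) C_subset, of "\<sigma> n"] by simp
      also have "\<dots> \<le> exp 8" using \<gamma>(2) by simp
      finally show ?thesis using k(3)[of x "\<sigma> n"] k(2) by simp
    qed
    define R where "R = sqrt (exp 8 / k)"
    have "norm (\<sigma> n) \<le> R" if "n \<ge> N" for n
      unfolding R_def using bound[OF that] k(1) by (intro real_le_rsqrt) (simp add: field_simps)
    then have in_K: "\<forall>n. \<sigma> (n + N) \<in> C \<inter> cball 0 R"
      using \<sigma>C by auto
    have "compact (C \<inter> cball 0 R)"
      using closed_components[OF assms C] by (intro closed_Int_compact compact_cball)
    then obtain l r where lr: "l \<in> C" "strict_mono r" "((\<lambda>n. \<sigma> (n + N)) \<circ> r) \<longlonglongrightarrow> l"
      using in_K unfolding compact_def by (metis IntD1)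
    have "(\<lambda>n. rdist (\<sigma> (r n + N)) l) \<longlonglongrightarrow> 0"
      using rdist_tendsto_0[OF lr(1), of "\<lambda>n. \<sigma> (r n + N)"] \<sigma>C lr(3) by (simp add: o_def)
    then have "limitin M.mtopology (\<sigma> \<circ> (\<lambda>n. r n + N)) l sequentially"
      using lr(1) \<sigma>C by (simp add: M.limitin_metric_dist_null)
    moreover have "strict_mono (\<lambda>n. r n + N)"
      using lr(2) by (simp add: strict_mono_def)
    ultimately have "limitin M.mtopology \<sigma> l sequentially"
      using M.MCauchy_convergent_subsequence[OF \<sigma>] by blast
    then show "\<exists>l. limitin M.mtopology \<sigma> l sequentially" ..
  qed
qed

end

section \<open>Hypersurfaces inside the level set\<close>

context symmetric_trilinear
begin

text \<open>A ray from the origin meets the level set at most once, so the part of the level set where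
  \<open>T p p\<close> is positive embeds into the affine hyperplane on which \<open>T p p\<close> equals 1.\<close>

lemma level_set_rays_inj:
  assumes "x \<in> level_set" "y \<in> level_set" "T p p x > 0" "T p p y > 0"
    and eq: "(1 / T p p x) *\<^sub>R x = (1 / T p p y) *\<^sub>R y"
  shows "x = y"
proof -
  define r where "r = T p p x / T p p y"
  have "r > 0" using assms by (simp add: r_def)
  have "x = T p p x *\<^sub>R ((1 / T p p x) *\<^sub>R x)" using assms(3) by simp
  also have "\<dots> = r *\<^sub>R y" unfolding eq by (simp add: r_def)
  finally have x: "x = r *\<^sub>R y" .
  then have "r ^ 3 = 1"
    using assms(1,2) by (simp add: level_set_def trilinear_simps power3_eq_cube)
  with \<open>r > 0\<close> have "r = 1"
    using power_eq_1_iff[of r 3] by auto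
  with x show ?thesis by simp
qed

lemma representing_vector:
  "\<exists>a. \<forall>v. T x y v = a \<bullet> v"
proof (intro exI allI)
  fix v
  have lin: "linear (T x y)"
    by (rule linearI) (simp_all add: trilinear_simps)
  have "T x y v = T x y (\<Sum>b\<in>Basis. (v \<bullet> b) *\<^sub>R b)"
    by (simp add: euclidean_representation)
  also have "\<dots> = (\<Sum>b\<in>Basis. (v \<bullet> b) * T x y b)"
    by (simp add: linear_sum[OF lin] scale3)
  also have "\<dots> = (\<Sum>b\<in>Basis. T x y b *\<^sub>R b) \<bullet> v"
    by (simp add: inner_sum_left inner_commute[of v] mult.commute)
  finally show "T x y v = (\<Sum>b\<in>Basis. T x y b *\<^sub>R b) \<bullet> v" .
qed

end

text \<open>Near \<open>p\<close> the hypersurface is parametrised by an open piece of a coordinate hyperplane.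
  Followed by the projection along rays, the parametrisation is a continuous injection into the
  kernel of \<open>T p p\<close>, a hyperplane too. By invariance of domain its image is open, hence covers the
  rays through all points of the level set near \<open>p\<close>.\<close>

lemma hypersurface_open_in_level_set:
  fixes T :: "real^'m \<Rightarrow> real^'m \<Rightarrow> real^'m \<Rightarrow> real"
  assumes T: "symmetric_trilinear T" and H: "smooth_hypersurface H"
    and sub: "H \<subseteq> symmetric_trilinear.level_set T"
  shows "openin (top_of_set (symmetric_trilinear.level_set T)) H"
proof -
  interpret symmetric_trilinear T by (rule T)
  show ?thesis
  proof (subst openin_subopen, intro ballI)
    fix p assume p: "p \<in> H"
    then have Tp: "T p p p = 1" using sub by (auto simp: level_set_def)
    obtain U V \<Phi> \<Psi> k where U: "open U" "p \<in> U" and V: "open (V :: (real^'m) set)"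
      and hom: "homeomorphism U V \<Phi> \<Psi>" and img: "\<Phi> ` (H \<inter> U) = V \<inter> {y. y $ k = 0}"
      using H p unfolding smooth_hypersurface_def by metis
    define A where "A = {y :: real^'m. y $ k = 0}"
    define K where "K = {v. T p p v = 0}"
    obtain a where a: "\<And>v. T p p v = a \<bullet> v" using representing_vector[of p p] by blast
    have "a \<noteq> 0" using Tp a[of p] by auto
    have K': "K = {v. a \<bullet> v = 0}" by (simp add: K_def a)
    have A': "A = {y. axis k 1 \<bullet> y = 0}" by (simp add: A_def inner_axis')
    have dims: "dim K \<le> dim A"
      unfolding K' A' using \<open>a \<noteq> 0\<close> by (simp add: dim_hyperplane axis_eq_0_iff)
    have subspaces: "subspace A" "subspace K"
      unfolding K' A' by (rule subspace_hyperplane)+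
    define proj where "proj x = (1 / T p p x) *\<^sub>R x - p" for x
    define O1 where "O1 = {x. T p p x > 0}"
    have "open O1" unfolding O1_def by (intro open_Collect_less continuous_intros)
    have proj_cont: "continuous_on O1 proj"
      unfolding proj_def by (intro continuous_intros) (auto simp: O1_def)
    have proj_inj: "x = y" if "x \<in> level_set" "y \<in> level_set" "x \<in> O1" "y \<in> O1" "proj x = proj y" for x y
      using that by (intro level_set_rays_inj[of x y p]) (auto simp: O1_def proj_def)
    define S where "S = A \<inter> (V \<inter> \<Psi> -` O1)"
    have \<Psi>_cont: "continuous_on V \<Psi>" using hom by (simp add: homeomorphism_def)
    have \<Psi>H: "\<Psi> y \<in> H" if "y \<in> S" for y
    proof -
      have "y \<in> \<Phi> ` (H \<inter> U)" using that unfolding img by (auto simp: S_def A_def)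
      then show ?thesis using hom by (auto simp: homeomorphism_def)
    qed
    have "openin (top_of_set K) ((proj \<circ> \<Psi>) ` S)"
    proof (rule invariance_of_domain_subspaces[OF _ subspaces dims])
      show "openin (top_of_set A) S"
        unfolding S_def using continuous_open_preimage[OF \<Psi>_cont V \<open>open O1\<close>]
        by (rule openin_open_Int)
      show "continuous_on S (proj \<circ> \<Psi>)"
        by (intro continuous_on_compose continuous_on_subset[OF \<Psi>_cont] continuous_on_subset[OF proj_cont])
          (auto simp: S_def)
      show "proj \<circ> \<Psi> \<in> S \<rightarrow> K"
        by (auto simp: S_def K_def proj_def O1_def trilinear_simps Tp)
      show "inj_on (proj \<circ> \<Psi>) S"
      proof (rule inj_onI)
        fix x y assume xy: "x \<in> S" "y \<in> S" "(proj \<circ> \<Psi>) x = (proj \<circ> \<Psi>) y"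
        have "\<Psi> x \<in> level_set" "\<Psi> y \<in> level_set"
          using \<Psi>H[OF xy(1)] \<Psi>H[OF xy(2)] sub by blast+
        moreover have "\<Psi> x \<in> O1" "\<Psi> y \<in> O1" using xy(1,2) by (simp_all add: S_def)
        ultimately have "\<Psi> x = \<Psi> y" using xy(3)[unfolded comp_apply] by (rule proj_inj)
        moreover have "\<Phi> (\<Psi> x) = x" "\<Phi> (\<Psi> y) = y"
          using hom xy by (auto simp: homeomorphism_def S_def)
        ultimately show "x = y" by metis
      qed
    qed
    then obtain O2 where O2: "open O2" "(proj \<circ> \<Psi>) ` S = K \<inter> O2"
      by (auto simp: openin_open)
    define W where "W = level_set \<inter> (O1 \<inter> proj -` O2)"
    have "openin (top_of_set level_set) W"
      unfolding W_def using continuous_open_preimage[OF proj_cont \<open>open O1\<close> O2(1)]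
      by (rule openin_open_Int)
    moreover have "p \<in> W"
    proof -
      have "\<Phi> p \<in> V \<inter> {y. y $ k = 0}" using img p U(2) by blast
      moreover have "\<Psi> (\<Phi> p) = p" using hom U(2) by (auto simp: homeomorphism_def)
      ultimately have "\<Phi> p \<in> S" "(proj \<circ> \<Psi>) (\<Phi> p) = proj p"
        by (auto simp: S_def A_def O1_def Tp)
      then have "proj p \<in> K \<inter> O2" using O2(2) by (metis image_eqI)
      then show ?thesis using p sub by (auto simp: W_def O1_def Tp)
    qed
    moreover have "W \<subseteq> H"
    proof
      fix x assume x: "x \<in> W"
      then have "proj x \<in> K \<inter> O2"
        by (auto simp: W_def K_def proj_def O1_def trilinear_simps Tp)
      then obtain y where y: "y \<in> S" "proj x = proj (\<Psi> y)"
        using O2(2) by (metis comp_apply imageE)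
      have "x \<in> level_set" "\<Psi> y \<in> level_set"
        using x \<Psi>H[OF y(1)] sub by (auto simp: W_def)
      moreover have "x \<in> O1" "\<Psi> y \<in> O1"
        using x y(1) by (simp_all add: W_def S_def)
      ultimately have "x = \<Psi> y" using y(2) by (rule proj_inj)
      with \<Psi>H[OF y(1)] show "x \<in> H" by simp
    qed
    ultimately show "\<exists>W. openin (top_of_set level_set) W \<and> p \<in> W \<and> W \<subseteq> H" by blast
  qed
qed

section \<open>Tangent vectors are velocities\<close>

lemma Ck_on_cong:
  assumes "open S" "\<And>x. x \<in> S \<Longrightarrow> f x = g x" "Ck_on k S f"
  shows "Ck_on k S g"
  using assms(2,3)
proof (induction k arbitrary: f g)
  case 0
  then show ?case by (metis Ck_on.simps(1) continuous_on_eq)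
next
  case (Suc k)
  have eq: "(g has_derivative D) (at x) \<longleftrightarrow> (f has_derivative D) (at x)" if "x \<in> S" for x D
    using has_derivative_transform_within_open[OF _ assms(1) that, of f D UNIV g]
      has_derivative_transform_within_open[OF _ assms(1) that, of g D UNIV f] Suc.prems(1) by auto
  have "g differentiable at x" if "x \<in> S" for x
    using Suc.prems(2) that eq[OF that] by (simp add: differentiable_def)
  moreover have "Ck_on k S (\<lambda>x. frechet_derivative g (at x) v)" for v
  proof (rule Suc.IH[of "\<lambda>x. frechet_derivative f (at x) v"])
    show "frechet_derivative f (at x) v = frechet_derivative g (at x) v" if "x \<in> S" for x
      by (simp add: frechet_derivative_def eq[OF that])
  qed (use Suc.prems(2) in simp)
  ultimately show ?case by simp
qed

text \<open>Functions of this shape are closed under differentiation, which is why their smoothness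
  follows by induction. Central projections of affine lines have this shape.\<close>

lemma Ck_on_powr_poly:
  fixes F P Q :: "real poly" and x y :: "'b::real_normed_vector"
  assumes "open S" "\<And>t. t \<in> S \<Longrightarrow> poly F t > 0"
  shows "Ck_on k S (\<lambda>t. poly F t powr a *\<^sub>R (poly P t *\<^sub>R x + poly Q t *\<^sub>R y))"
proof (induction k arbitrary: a P Q)
  case 0
  have "continuous_on S (\<lambda>t. poly F t powr a *\<^sub>R (poly P t *\<^sub>R x + poly Q t *\<^sub>R y))"
    using assms(2) by (intro continuous_intros) force+
  then show ?case by simp
next
  case (Suc k)
  let ?f = "\<lambda>t. poly F t powr a *\<^sub>R (poly P t *\<^sub>R x + poly Q t *\<^sub>R y)"
  define P' where "P' = smult a (pderiv F * P) + F * pderiv P"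
  define Q' where "Q' = smult a (pderiv F * Q) + F * pderiv Q"
  define D where "D t = poly F t powr (a - 1) *\<^sub>R (poly P' t *\<^sub>R x + poly Q' t *\<^sub>R y)" for t
  have d: "(?f has_derivative (\<lambda>v. v *\<^sub>R D t)) (at t)" if "t \<in> S" for t
  proof -
    have pos: "poly F t > 0" using assms(2)[OF that] .
    have "((\<lambda>t. poly F t powr a) has_real_derivative (a * poly F t powr (a - 1) * poly (pderiv F) t)) (at t)"
      using DERIV_fun_powr[OF poly_DERIV pos, of a] by simp
    moreover have "((\<lambda>t. poly P t *\<^sub>R x + poly Q t *\<^sub>R y) has_vector_derivative
        poly (pderiv P) t *\<^sub>R x + poly (pderiv Q) t *\<^sub>R y) (at t)"
      using has_vector_derivative_scaleR[OF poly_DERIV has_vector_derivative_const]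
      by (intro has_vector_derivative_add) (auto intro: has_vector_derivative_eq_rhs)
    ultimately have "(?f has_vector_derivative
        poly F t powr a *\<^sub>R (poly (pderiv P) t *\<^sub>R x + poly (pderiv Q) t *\<^sub>R y)
        + (a * poly F t powr (a - 1) * poly (pderiv F) t) *\<^sub>R (poly P t *\<^sub>R x + poly Q t *\<^sub>R y)) (at t)"
      by (rule has_vector_derivative_scaleR)
    moreover have "poly F t powr a = poly F t powr (a - 1) * poly F t"
      using pos powr_add[of "poly F t" "a - 1" 1] by simp
    then have "poly F t powr a *\<^sub>R (poly (pderiv P) t *\<^sub>R x + poly (pderiv Q) t *\<^sub>R y)
        + (a * poly F t powr (a - 1) * poly (pderiv F) t) *\<^sub>R (poly P t *\<^sub>R x + poly Q t *\<^sub>R y) = D t"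
      by (simp add: D_def P'_def Q'_def algebra_simps)
    ultimately have "(?f has_vector_derivative D t) (at t)"
      by simp
    then show ?thesis by (simp add: has_vector_derivative_def)
  qed
  have "Ck_on k S (\<lambda>t. frechet_derivative ?f (at t) v)" for v
  proof (rule Ck_on_cong[OF assms(1) _ Suc.IH[of "a - 1" "smult v P'" "smult v Q'"]])
    fix t assume "t \<in> S"
    from frechet_derivative_at[OF d[OF this], symmetric]
    show "poly F t powr (a - 1) *\<^sub>R (poly (smult v P') t *\<^sub>R x + poly (smult v Q') t *\<^sub>R y)
        = frechet_derivative ?f (at t) v"
      by (simp add: D_def algebra_simps)
  qed
  moreover have "?f differentiable at t" if "t \<in> S" for t
    using d[OF that] by (rule differentiableI)
  ultimately show ?case by simp
qed

text \<open>The central projection of the line \<open>t \<mapsto> p + t *\<^sub>R w\<close> has velocity \<open>w\<close> at \<open>p\<close>, and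
  stays in \<open>H\<close> for small \<open>t\<close> because \<open>H\<close> is open in the level set.\<close>

lemma kernel_subset_tangent_space:
  fixes T :: "real^'m \<Rightarrow> real^'m \<Rightarrow> real^'m \<Rightarrow> real"
  assumes T: "symmetric_trilinear T" and "H \<subseteq> symmetric_trilinear.level_set T"
    and op: "openin (top_of_set (symmetric_trilinear.level_set T)) H"
    and p: "p \<in> H" "T p p w = 0"
  shows "w \<in> tangent_space H p"
proof -
  interpret symmetric_trilinear T by (rule T)
  have pl: "p \<in> level_set" "T p p p = 1" using assms(2) p(1) by (auto simp: level_set_def)
  obtain U where U: "open U" "H = level_set \<inter> U" using op by (auto simp: openin_open)
  define l where "l t = p + t *\<^sub>R w" for t :: real
  define \<gamma> where "\<gamma> t = central_projection (l t)" for t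
  define F where "F = [:1, 0, 3 * T p w w, T w w w:]"
  have F: "T (l t) (l t) (l t) = poly F t" for t
    using p(2) swap23[of p w p] swap_last_to_first[of w p p] swap12[of w p w] swap_last_to_first[of p w w]
    by (simp add: l_def F_def trilinear_simps pl(2) algebra_simps)
  have \<gamma>: "\<gamma> = (\<lambda>t. poly F t powr (-1/3) *\<^sub>R (poly 1 t *\<^sub>R p + poly [:0, 1:] t *\<^sub>R w))"
    by (simp add: fun_eq_iff \<gamma>_def central_projection_def F) (simp add: l_def)
  define J where "J = {t. poly F t > 0}"
  have "open J" unfolding J_def by (intro open_Collect_less continuous_intros)
  have lcont: "continuous_on J l" unfolding l_def by (intro continuous_intros)
  have "continuous_on J \<gamma>"
    unfolding \<gamma>_def by (rule continuous_on_central_projection[OF lcont]) (simp add: F J_def)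
  then have "open (J \<inter> \<gamma> -` U)"
    using \<open>open J\<close> U(1) by (rule continuous_open_preimage)
  moreover have \<gamma>0: "\<gamma> 0 = p" using pl(1) by (simp add: \<gamma>_def l_def central_projection_id)
  then have "0 \<in> J \<inter> \<gamma> -` U" using p(1) U(2) by (simp add: J_def F_def)
  ultimately obtain e where e: "e > 0" "ball 0 e \<subseteq> J \<inter> \<gamma> -` U"
    unfolding open_contains_ball by blast
  have ball: "{-e<..<e} = ball 0 e"
    by (auto simp: ball_def dist_real_def)
  have "Ck_on k (ball 0 e) \<gamma>" for k
    unfolding \<gamma> by (rule Ck_on_powr_poly) (use e(2) in \<open>auto simp: J_def\<close>)
  then have "smooth_map_on {-e<..<e} \<gamma>"
    by (simp add: smooth_map_on_def ball)
  moreover have "\<gamma> ` {-e<..<e} \<subseteq> H"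
  proof
    fix z assume "z \<in> \<gamma> ` {-e<..<e}"
    then obtain t where t: "t \<in> J" "\<gamma> t \<in> U" "z = \<gamma> t"
      using e(2) unfolding ball by blast
    then have "\<gamma> t \<in> level_set"
      unfolding \<gamma>_def by (intro central_projection_in_level_set) (simp add: F J_def)
    with t U(2) show "z \<in> H" by auto
  qed
  moreover have "(\<gamma> has_vector_derivative w) (at 0)"
  proof -
    have "(l has_vector_derivative w) (at 0)"
      unfolding l_def by (auto intro!: derivative_eq_intros)
    from central_projection_has_vector_derivative[OF this] show ?thesis
      unfolding \<gamma>_def using p(2) pl(2) by (simp add: l_def projection_derivative_def)
  qed
  ultimately show ?thesis
    using e(1) \<gamma>0 unfolding tangent_space_def by blast
qed

section \<open>From cubic polynomials to trilinear forms\<close>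

text \<open>Averaging the given coefficients over the six orders of the arguments makes the form
  symmetric without changing its values on the diagonal.\<close>

lemma homogeneous_cubic_polarisation:
  assumes "homogeneous_cubic (h :: real^'m \<Rightarrow> real)"
  obtains T where "symmetric_trilinear T" "h = (\<lambda>x. T x x x)"
proof -
  obtain c where c: "\<And>x. h x = (\<Sum>i\<in>UNIV. \<Sum>j\<in>UNIV. \<Sum>k\<in>UNIV. c i j k * x $ i * x $ j * x $ k)"
    using assms unfolding homogeneous_cubic_def by blast
  define T :: "real^'m \<Rightarrow> real^'m \<Rightarrow> real^'m \<Rightarrow> real" where
    "T x y z = (\<Sum>i\<in>UNIV. \<Sum>j\<in>UNIV. \<Sum>k\<in>UNIV. c i j k / 6 *
      (x$i * y$j * z$k + x$i * z$j * y$k + y$i * x$j * z$k + y$i * z$j * x$k + z$i * x$j * y$k + z$i * y$j * x$k))"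
    for x y z
  have "symmetric_trilinear T"
  proof (rule symmetric_trilinear.intro)
    show "T x y z = T y x z" "T x y z = T x z y" for x y z
      unfolding T_def by (simp_all add: add_ac)
    show "linear (\<lambda>x. T x y z)" for y z
    proof (rule linearI)
      show "T (x + x') y z = T x y z + T x' y z" for x x'
        unfolding T_def by (simp add: sum.distrib[symmetric] algebra_simps)
      show "T (r *\<^sub>R x) y z = r *\<^sub>R T x y z" for r x
        unfolding T_def by (simp add: sum_distrib_left algebra_simps)
    qed
  qed
  moreover have "h = (\<lambda>x. T x x x)"
    by (simp add: fun_eq_iff c T_def mult.assoc)
  ultimately show thesis by (rule that)
qed

lemma hessian_cubic:
  fixes T :: "real^'m \<Rightarrow> real^'m \<Rightarrow> real^'m \<Rightarrow> real"
  assumes "symmetric_trilinear T"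
  shows "hessian (\<lambda>x. T x x x) p v w = 6 * T p v w"
proof -
  interpret symmetric_trilinear T by (rule assms)
  have perm: "T d x x = T x x d" "T x d x = T x x d" for x d
    by (rule swap_last_to_first, rule swap23)
  have "((\<lambda>x. T x x x) has_derivative (\<lambda>d. 3 * T x x d)) (at x)" for x
    by (rule has_derivative_eq_rhs[OF has_derivative_T[OF has_derivative_ident has_derivative_ident has_derivative_ident]])
      (simp add: fun_eq_iff perm[where x = x])
  from frechet_derivative_at[OF this, symmetric]
  have 1: "(\<lambda>x. frechet_derivative (\<lambda>x. T x x x) (at x) w) = (\<lambda>x. 3 * T x x w)"
    by simp
  have "((\<lambda>x. 3 * T x x w) has_derivative (\<lambda>d. 3 * (T d p w + T p d w + T p p 0))) (at p)"
    by (intro has_derivative_mult_right has_derivative_T has_derivative_ident has_derivative_const)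
  from frechet_derivative_at[OF this, symmetric] show ?thesis
    unfolding hessian_def 1 using swap12[of v p w] by simp
qed

theorem theorem2p5:
  fixes n :: nat and H :: "(real^'m) set" and h :: "real^'m \<Rightarrow> real"
  assumes "n \<ge> 1" and "CARD('m) = n + 1"
    and "projective_special_real_manifold H"
    and "defining_cubic H h"
  shows "riemannian_complete H (centroaffine_metric h) \<longleftrightarrow> closed H"
proof -
  have H: "smooth_hypersurface H"
    using assms(3) by (simp add: projective_special_real_manifold_def)
  have h: "homogeneous_cubic h" "H \<subseteq> {x. h x = 1}"
    "\<And>p v. p \<in> H \<Longrightarrow> v \<in> tangent_space H p \<Longrightarrow> v \<noteq> 0 \<Longrightarrow> hessian h p v v < 0"
    using assms(4) by (auto simp: defining_cubic_def)
  obtain T where T: "symmetric_trilinear T" and hT: "h = (\<lambda>x. T x x x)"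
    using homogeneous_cubic_polarisation[OF h(1)] .
  interpret symmetric_trilinear T by (rule T)
  have sub: "H \<subseteq> level_set" using h(2) by (simp add: level_set_def hT)
  have op: "openin (top_of_set level_set) H"
    by (rule hypersurface_open_in_level_set[OF T H sub])
  interpret special_real_hypersurface T H
  proof
    show "openin (top_of_set level_set) H" by (rule op)
    show "T p v v < 0" if "p \<in> H" "T p p v = 0" "v \<noteq> 0" for p v
    proof -
      have "hessian h p v v < 0"
        using h(3)[OF that(1) kernel_subset_tangent_space[OF T sub op that(1,2)] that(3)] .
      then show ?thesis by (simp add: hT hessian_cubic[OF T])
    qed
  qed
  have "centroaffine_metric h = metric"
    by (simp add: fun_eq_iff centroaffine_metric_def metric_def hT hessian_cubic[OF T])
  then show ?thesis
    using complete_imp_closed closed_imp_complete by auto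
qed

end
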